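(* Let \[ \alpha(n)=\min\{\lambda_1(G): G \text{ is a simple connected graph on } n \text{ vertices}\}. \] Then $\alpha(n)\sim \dfrac{54}{n^3}$ as $n\to\infty$, i.e. $\alpha(n)\,n^3/54\to 1$.
   Context: For a simple graph $G$ with degree function $d$, the normalized Laplacian is $\mathcal{L}=I-T^{-1/2}AT^{-1/2}$, where $A$ is the adjacency matrix and $T$ the diagonal degree matrix. Its eigenvalues are $0=\lambda_0\le\lambda_1\le\dots\le\lambda_{n-1}$, and $\lambda_1(G)$ denotes the second smallest one (the spectral gap). *)

theory Defs
  imports "Jordan_Normal_Form.Char_Poly" "HOL-Library.Multiset"
begin

definition simple_graph_on :: "nat \<Rightarrow> (nat \<Rightarrow> nat \<Rightarrow> bool) \<Rightarrow> bool" where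
  "simple_graph_on n E \<longleftrightarrow>
     (\<forall>i j. E i j \<longrightarrow> i < n \<and> j < n) \<and> (\<forall>i j. E i j \<longrightarrow> E j i) \<and> (\<forall>i. \<not> E i i)"

definition connected_graph_on :: "nat \<Rightarrow> (nat \<Rightarrow> nat \<Rightarrow> bool) \<Rightarrow> bool" where
  "connected_graph_on n E \<longleftrightarrow> simple_graph_on n E \<and> (\<forall>i<n. \<forall>j<n. E\<^sup>*\<^sup>* i j)"

definition degree :: "nat \<Rightarrow> (nat \<Rightarrow> nat \<Rightarrow> bool) \<Rightarrow> nat \<Rightarrow> nat" where
  "degree n E i = card {j. j < n \<and> E i j}"

definition norm_laplacian :: "nat \<Rightarrow> (nat \<Rightarrow> nat \<Rightarrow> bool) \<Rightarrow> real mat" where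
  "norm_laplacian n E = mat n n (\<lambda>(i,j).
      (if i = j then 1 else 0)
      - (if E i j then 1 else 0) / (sqrt (real (degree n E i)) * sqrt (real (degree n E j))))"

definition laplacian_eigenvalues :: "nat \<Rightarrow> (nat \<Rightarrow> nat \<Rightarrow> bool) \<Rightarrow> real list" where
  "laplacian_eigenvalues n E = sorted_list_of_multiset (proots (char_poly (norm_laplacian n E)))"

definition lambda1 :: "nat \<Rightarrow> (nat \<Rightarrow> nat \<Rightarrow> bool) \<Rightarrow> real" where
  "lambda1 n E = laplacian_eigenvalues n E ! 1"

definition alpha :: "nat \<Rightarrow> real" where
  "alpha n = Min {lambda1 n E | E. connected_graph_on n E}"

end

theory Submission
  imports Defs "HOL-Analysis.Convex" "HOL-Real_Asymp.Real_Asymp"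
begin

text \<open>
  Upper bound: two cliques on \<open>n/3\<close> vertices joined by a path on the remaining \<open>n/3\<close>, with the test
  function that is constant on each clique and linear along the path.

  Lower bound: let \<open>f\<close> have degree-weighted mean \<open>0\<close> and sort the vertices by \<open>f\<close>. If \<open>c\<^sub>k\<close> edges cross the
  \<open>k\<close>-th cut of this order and \<open>M\<^sub>1(k)\<close>, \<open>M\<^sub>2(k)\<close> are the volumes of its two sides, then Cauchy-Schwarz gives
  \<open>\<Sum> d f\<^sup>2 \<le> energy f * (\<Sum>k. M\<^sub>1(k) M\<^sub>2(k) / (c\<^sub>k (M\<^sub>1(k) + M\<^sub>2(k))))\<close>.
  Cuts with \<open>c\<^sub>k > K\<close> contribute at most \<open>n\<^sup>3 / K\<close>. If there are \<open>G\<close> further (sparse) cuts, these break the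
  order into \<open>G + 1\<close> blocks with few edges between them, so at a sparse cut the volumes are at most about
  \<open>a\<^sup>2\<close> and \<open>b\<^sup>2\<close> with \<open>a + b \<le> n - G\<close>. The harmonic mean estimate
  \<open>a\<^sup>2 b\<^sup>2 / (a\<^sup>2 + b\<^sup>2) \<le> (a + b)\<^sup>2 / 8\<close> bounds the sum by
  \<open>G (n - G)\<^sup>2 / 8 \<le> n\<^sup>3 / 54\<close> up to lower-order terms.
\<close>

section \<open>Elementary inequalities\<close>

lemma sum_squares_le_square_sum:
  fixes g :: "'a \<Rightarrow> real"
  assumes "finite A" "\<And>a. a \<in> A \<Longrightarrow> 0 \<le> g a"
  shows "(\<Sum>a\<in>A. (g a)\<^sup>2) \<le> (\<Sum>a\<in>A. g a)\<^sup>2"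
  using assms
proof (induction A rule: finite_induct)
  case (insert x A)
  then have "0 \<le> 2 * g x * sum g A"
    by (simp add: sum_nonneg)
  with insert show ?case
    by (simp add: power2_sum)
qed simp

lemma weighted_Cauchy_Schwarz:
  fixes c x :: "'a \<Rightarrow> real"
  assumes "\<And>a. a \<in> A \<Longrightarrow> 0 < c a"
  shows "(\<Sum>a\<in>A. x a)\<^sup>2 \<le> (\<Sum>a\<in>A. c a * (x a)\<^sup>2) * (\<Sum>a\<in>A. 1 / c a)"
proof -
  have "(\<Sum>a\<in>A. x a) = (\<Sum>a\<in>A. (sqrt (c a) * x a) * (1 / sqrt (c a)))"
    using assms by (intro sum.cong) (auto simp: less_imp_neq[symmetric] dest: assms)
  then have "(\<Sum>a\<in>A. x a)\<^sup>2 \<le> (\<Sum>a\<in>A. (sqrt (c a) * x a)\<^sup>2) * (\<Sum>a\<in>A. (1 / sqrt (c a))\<^sup>2)"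
    by (simp only: Cauchy_Schwarz_ineq_sum)
  also have "\<dots> = (\<Sum>a\<in>A. c a * (x a)\<^sup>2) * (\<Sum>a\<in>A. 1 / c a)"
    using assms by (simp add: power_mult_distrib power_divide less_imp_le cong: sum.cong)
  finally show ?thesis .
qed

text \<open>Half the harmonic mean increases in each argument: after cross-multiplication the
  difference is \<open>x * X * (Y - y) + y * Y * (X - x)\<close>.\<close>

lemma mult_div_add_mono:
  fixes x y X Y :: real
  assumes "0 \<le> x" "0 \<le> y" "x \<le> X" "y \<le> Y" "0 < x + y"
  shows "x * y / (x + y) \<le> X * Y / (X + Y)"
proof -
  have "0 \<le> x * X * (Y - y) + y * Y * (X - x)"
    using assms by (intro add_nonneg_nonneg mult_nonneg_nonneg) auto
  then have "x * y * (X + Y) \<le> X * Y * (x + y)"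
    by (simp add: algebra_simps)
  then show ?thesis
    using assms by (simp add: divide_simps)
qed

text \<open>By monotonicity it suffices to treat x = \<open>p\<^sup>2\<close> and y =
  \<open>q\<^sup>2\<close>, where clearing denominators leaves a multiple of
  \<open>(p - q)\<^sup>2\<close>. Equality at p = q reflects that two cliques of equal size are
  extremal.\<close>

lemma mult_div_add_le_eighth_square:
  fixes x y p q :: real
  assumes "0 \<le> x" "0 \<le> y" "0 < x + y" "x \<le> p\<^sup>2" "y \<le> q\<^sup>2" "0 \<le> p" "0 \<le> q"
  shows "x * y / (x + y) \<le> (p + q)\<^sup>2 / 8"
proof -
  have "x * y / (x + y) \<le> p\<^sup>2 * q\<^sup>2 / (p\<^sup>2 + q\<^sup>2)"
    by (rule mult_div_add_mono) (use assms in auto)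
  also have "\<dots> \<le> (p + q)\<^sup>2 / 8"
  proof -
    have "(p + q)\<^sup>2 * (p\<^sup>2 + q\<^sup>2) - 8 * (p\<^sup>2 * q\<^sup>2)
        = (p - q)\<^sup>2 * (p\<^sup>2 + q\<^sup>2 + 4 * (p * q))"
      by (simp add: power2_eq_square algebra_simps)
    also have "\<dots> \<ge> 0"
      using assms by simp
    finally have *: "8 * (p\<^sup>2 * q\<^sup>2) \<le> (p + q)\<^sup>2 * (p\<^sup>2 + q\<^sup>2)" by simp
    have "0 < p\<^sup>2 + q\<^sup>2" using assms by linarith
    with * show ?thesis by (simp add: divide_simps mult.commute)
  qed
  finally show ?thesis .
qed

text \<open>The cubic has its maximum on [0, N] at x = N / 3, so the difference has a double root
  there. Here x will be the number of sparse cuts, and this maximum divided by 8 produces the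
  constant 1 / 54.\<close>

lemma mult_square_le_cube:
  fixes x N :: real
  assumes "0 \<le> x" "x \<le> N"
  shows "x * (N - x)\<^sup>2 \<le> 4 * N ^ 3 / 27"
proof -
  have "4 * N ^ 3 / 27 - x * (N - x)\<^sup>2 = (x - N / 3)\<^sup>2 * (4 * N / 3 - x)"
    by (simp add: power2_eq_square power3_eq_cube field_simps)
  also have "\<dots> \<ge> 0" using assms by simp
  finally show ?thesis by simp
qed

section \<open>Rearranging finite and double sums\<close>

lemma card_rel_eq_sum:
  assumes "finite A" "\<And>i. i \<in> A \<Longrightarrow> finite (B i)"
  shows "card {(i, j). i \<in> A \<and> j \<in> B i} = (\<Sum>i\<in>A. card (B i))"
proof -
  have "{(i, j). i \<in> A \<and> j \<in> B i} = Sigma A B" by auto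
  then show ?thesis using assms by simp
qed

lemma sum_telescope_gaps:
  fixes f :: "nat \<Rightarrow> real"
  assumes "i \<le> j"
  shows "(\<Sum>k\<in>{i<..j}. f k - f (k - 1)) = f j - f i"
  using assms
proof (induction j rule: dec_induct)
  case (step m)
  then have "{i<..Suc m} = insert (Suc m) {i<..m}" by auto
  with step show ?case by simp
qed simp

lemma sum_pairs_less_double:
  fixes F :: "nat \<Rightarrow> nat \<Rightarrow> real"
  assumes "\<And>i j. F i j = F j i" "\<And>i. F i i = 0"
  shows "(\<Sum>i<n. \<Sum>j<n. F i j) = 2 * (\<Sum>(i, j) | i < j \<and> j < n. F i j)"
proof -
  let ?L = "{(i, j). i < j \<and> j < (n::nat)}"
  let ?G = "prod.swap ` ?L"
  have fin: "finite ?L"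
    by (rule finite_subset[of _ "{..<n} \<times> {..<n}"]) auto
  have split: "{..<n} \<times> {..<n} = (?L \<union> ?G) \<union> (\<lambda>i. (i, i)) ` {..<n}"
    by (auto simp: image_iff)
  have "(\<Sum>i<n. \<Sum>j<n. F i j) = (\<Sum>(i, j)\<in>{..<n} \<times> {..<n}. F i j)"
    by (simp add: sum.cartesian_product)
  also have "\<dots> = (\<Sum>(i, j)\<in>?L \<union> ?G. F i j) + (\<Sum>(i, j)\<in>(\<lambda>i. (i, i)) ` {..<n}. F i j)"
    unfolding split using fin by (intro sum.union_disjoint) auto
  also have "(\<Sum>(i, j)\<in>(\<lambda>i. (i, i)) ` {..<n}. F i j) = 0"
    using assms(2) by (intro sum.neutral) auto
  also have "(\<Sum>(i, j)\<in>?L \<union> ?G. F i j) = (\<Sum>(i, j)\<in>?L. F i j) + (\<Sum>(i, j)\<in>?G. F i j)"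
    using fin by (intro sum.union_disjoint) auto
  also have "(\<Sum>(i, j)\<in>?G. F i j) = (\<Sum>(i, j)\<in>?L. F i j)"
    using assms(1) by (subst sum.reindex) (auto simp: inj_on_def case_prod_unfold)
  finally show ?thesis by simp
qed

text \<open>When the weighted mean vanishes, this trades the weighted norm of f for differences over
  pairs, which can be estimated cut by cut.\<close>

lemma weighted_variance_identity:
  fixes d f :: "nat \<Rightarrow> real"
  shows "(\<Sum>(i, j) | i < j \<and> j < n. d i * d j * (f j - f i)\<^sup>2)
    = (\<Sum>i<n. d i) * (\<Sum>i<n. d i * (f i)\<^sup>2) - (\<Sum>i<n. d i * f i)\<^sup>2"
proof -
  have "2 * (\<Sum>(i, j) | i < j \<and> j < n. d i * d j * (f j - f i)\<^sup>2)
      = (\<Sum>i<n. \<Sum>j<n. d i * d j * (f j - f i)\<^sup>2)"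
    by (rule sum_pairs_less_double[symmetric]) (auto simp: power2_commute mult.commute)
  also have "\<dots> = (\<Sum>i<n. \<Sum>j<n. d i * (d j * (f j)\<^sup>2) + d i * (f i)\<^sup>2 * d j
      - d i * f i * (d j * f j) - d i * f i * (d j * f j))"
    by (simp add: power2_eq_square algebra_simps)
  also have "\<dots> = 2 * ((\<Sum>i<n. d i) * (\<Sum>i<n. d i * (f i)\<^sup>2) - (\<Sum>i<n. d i * f i)\<^sup>2)"
    by (simp only: sum.distrib sum_subtractf sum_product[symmetric]) (simp add: power2_eq_square)
  finally show ?thesis by simp
qed

text \<open>Cut k separates i < j exactly when i < k \<le> j. For fixed k these pairs form a
  rectangle, so their weights sum to the product of the weights of the two sides.\<close>

lemma sum_pairs_swap:
  fixes d r :: "nat \<Rightarrow> real"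
  shows "(\<Sum>(i, j) | i < j \<and> j < n. d i * d j * (\<Sum>k\<in>{i<..j}. r k))
    = (\<Sum>k\<in>{1..<n}. (\<Sum>i<k. d i) * (\<Sum>j\<in>{k..<n}. d j) * r k)"
proof -
  let ?P = "{(i, j). i < j \<and> j < (n::nat)}"
  have fin: "finite ?P"
    by (rule finite_subset[of _ "{..<n} \<times> {..<n}"]) auto
  have "(\<Sum>(i, j)\<in>?P. d i * d j * (\<Sum>k\<in>{i<..j}. r k))
      = (\<Sum>e\<in>?P. \<Sum>k\<in>{k \<in> {1..<n}. fst e < k \<and> k \<le> snd e}. d (fst e) * d (snd e) * r k)"
  proof (intro sum.cong refl, clarify)
    fix i j assume "i < j" "j < n"
    then have "{k \<in> {1..<n}. fst (i, j) < k \<and> k \<le> snd (i, j)} = {i<..j}" by auto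
    then show "d i * d j * sum r {i<..j} = (\<Sum>k | k \<in> {1..<n} \<and> fst (i, j) < k \<and> k \<le> snd (i, j).
        d (fst (i, j)) * d (snd (i, j)) * r k)"
      by (simp add: sum_distrib_left)
  qed
  also have "\<dots> = (\<Sum>k\<in>{1..<n}. \<Sum>e\<in>{e \<in> ?P. fst e < k \<and> k \<le> snd e}. d (fst e) * d (snd e) * r k)"
    using fin by (intro sum.swap_restrict) auto
  also have "\<dots> = (\<Sum>k\<in>{1..<n}. (\<Sum>i<k. d i) * (\<Sum>j\<in>{k..<n}. d j) * r k)"
  proof (rule sum.cong[OF refl])
    fix k assume "k \<in> {1..<n}"
    have "{e \<in> ?P. fst e < k \<and> k \<le> snd e} = {..<k} \<times> {k..<n}" by auto
    then show "(\<Sum>e\<in>{e \<in> ?P. fst e < k \<and> k \<le> snd e}. d (fst e) * d (snd e) * r k)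
        = (\<Sum>i<k. d i) * (\<Sum>j\<in>{k..<n}. d j) * r k"
      by (subst sum_product)
        (simp add: sum_distrib_right sum.cartesian_product case_prod_unfold)
  qed
  finally show ?thesis .
qed

section \<open>Sparse cuts of a linearly ordered graph\<close>

text \<open>The vertices are meant to be numbered in increasing order of f. Connectivity enters as
  the existence of an edge across each proper initial segment.\<close>

locale ordered_graph =
  fixes n :: nat and E :: "nat \<Rightarrow> nat \<Rightarrow> bool"
  assumes graph: "simple_graph_on n E"
    and cut_nonempty: "\<And>k. 0 < k \<Longrightarrow> k < n \<Longrightarrow> \<exists>i j. i < k \<and> k \<le> j \<and> E i j"
begin

lemma edge_less: "E i j \<Longrightarrow> i < n \<and> j < n"
  and edge_sym: "E i j \<Longrightarrow> E j i"
  and edge_irrefl: "\<not> E i i"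
  using graph by (auto simp: simple_graph_on_def)

text \<open>Cut k lies between the vertices k - 1 and k. Each crossing edge occurs once, oriented
  upward, whereas \<open>vol\<close> counts ordered pairs in both directions.\<close>

definition cut :: "nat \<Rightarrow> (nat \<times> nat) set" where
  "cut k = {(i, j). i < k \<and> k \<le> j \<and> E i j}"

lemma finite_edges: "finite {(i, j). E i j \<and> P i j}"
  by (rule finite_subset[of _ "{..<n} \<times> {..<n}"]) (auto dest: edge_less)

lemma finite_cut: "finite (cut k)"
  unfolding cut_def by (rule finite_subset[OF _ finite_edges[of "\<lambda>_ _. True"]]) auto

lemma card_cut_pos: "0 < k \<Longrightarrow> k < n \<Longrightarrow> 0 < card (cut k)"
  using cut_nonempty[of k] finite_cut by (auto simp: card_gt_0_iff cut_def)

definition vol :: "nat \<Rightarrow> nat \<Rightarrow> nat" where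
  "vol l h = (\<Sum>i\<in>{l..<h}. degree n E i)"

lemma vol_eq_card: "vol l h = card {(i, j). i \<in> {l..<h} \<and> j < n \<and> E i j}"
  using card_rel_eq_sum[of "{l..<h}" "\<lambda>i. {j. j < n \<and> E i j}"]
  by (simp add: vol_def degree_def)

lemma vol_add: "l \<le> k \<Longrightarrow> k \<le> h \<Longrightarrow> vol l k + vol k h = vol l h"
  unfolding vol_def by (rule sum.atLeastLessThan_concat)

lemma vol_le: "vol 0 n \<le> n\<^sup>2"
proof -
  have "degree n E i \<le> n" for i
    unfolding degree_def using card_mono[of "{..<n}" "{j. j < n \<and> E i j}"] by auto
  then have "vol 0 n \<le> (\<Sum>i\<in>{0..<n}. n)"
    unfolding vol_def by (intro sum_mono) auto
  then show ?thesis by (simp add: power2_eq_square)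
qed

lemma vol_pos:
  assumes "0 < k" "k < n"
  shows "0 < vol 0 k" "0 < vol k n"
proof -
  obtain i j where ij: "i < k" "k \<le> j" "E i j"
    using cut_nonempty assms by blast
  then have "(i, j) \<in> {(i, j). i \<in> {0..<k} \<and> j < n \<and> E i j}"
    and "(j, i) \<in> {(i, j). i \<in> {k..<n} \<and> j < n \<and> E i j}"
    using edge_less edge_sym by auto
  moreover have "finite {(i, j). i \<in> A \<and> j < n \<and> E i j}" for A
    by (rule finite_subset[OF _ finite_edges[of "\<lambda>_ _. True"]]) auto
  ultimately show "0 < vol 0 k" "0 < vol k n"
    unfolding vol_eq_card by (auto simp only: card_gt_0_iff)
qed

section \<open>Sparse cuts and the blocks between them\<close>

context
  fixes K :: real
begin

definition sparse_cuts :: "nat set" where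
  "sparse_cuts = {k \<in> {1..<n}. real (card (cut k)) \<le> K}"

text \<open>Position of i on the line after contracting every sparse cut. All n vertices then occupy
  only n - G positions, where G is the number of sparse cuts.\<close>

definition rank :: "nat \<Rightarrow> nat" where
  "rank i = card ({1..i} - sparse_cuts)"

text \<open>The relation of lying in the same block, that is, having no sparse cut in
  between.\<close>

definition unseparated :: "nat \<Rightarrow> nat \<Rightarrow> bool" where
  "unseparated i j \<longleftrightarrow> {min i j<..max i j} \<inter> sparse_cuts = {}"

lemma sparse_cuts_subset: "sparse_cuts \<subseteq> {1..<n}"
  by (auto simp: sparse_cuts_def)

lemma finite_sparse_cuts: "finite sparse_cuts"
  using sparse_cuts_subset finite_subset by blast

lemma rank_split:
  assumes "i \<le> j"
  shows "rank j = rank i + card ({i<..j} - sparse_cuts)"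
proof -
  have "{1..j} - sparse_cuts = ({1..i} - sparse_cuts) \<union> ({i<..j} - sparse_cuts)"
    using assms by auto
  then show ?thesis
    unfolding rank_def by (simp add: card_Un_disjoint Diff_Int_distrib2 disjoint_iff)
qed

lemma rank_mono: "i \<le> j \<Longrightarrow> rank i \<le> rank j"
  by (simp add: rank_split)

lemma rank_eq_imp_sparse:
  assumes "rank i = rank j" "i < k" "k \<le> j"
  shows "k \<in> sparse_cuts"
  using assms rank_split[of i j] by auto

lemma rank_less_if_unseparated:
  assumes "unseparated i j" "i < j"
  shows "rank i < rank j"
proof -
  have "j \<in> {i<..j} - sparse_cuts"
    using assms by (auto simp: unseparated_def)
  then have "0 < card ({i<..j} - sparse_cuts)"
    by (auto simp: card_gt_0_iff)
  then show ?thesis using rank_split[of i j] assms by simp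
qed

lemma unseparated_sym: "unseparated i j \<longleftrightarrow> unseparated j i"
  by (simp add: unseparated_def min.commute max.commute)

lemma unseparated_rank_less_iff:
  assumes "unseparated i j" "i \<noteq> j"
  shows "rank i < rank j \<longleftrightarrow> i < j"
  using assms rank_less_if_unseparated[of i j] rank_less_if_unseparated[of j i]
  by (auto simp: unseparated_sym[of j i] nat_neq_iff)

text \<open>If i < i' had equal ranks, all cuts between them would be sparse, so i would be last in
  its block and i' first in its own. Then j lies below i and j' above i', although equal ranks force
  both pairs to be ordered alike.\<close>

lemma unseparated_rank_inj:
  assumes "unseparated i j" "i \<noteq> j" "unseparated i' j'" "i' \<noteq> j'"
    and "rank i = rank i'" "rank j = rank j'"
  shows "\<not> i < i'"
proof
  assume "i < i'"
  then have sparse: "Suc i \<in> sparse_cuts" "i' \<in> sparse_cuts"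
    using rank_eq_imp_sparse[of i i'] assms by auto
  have "i < j \<longleftrightarrow> i' < j'"
    using assms unseparated_rank_less_iff by metis
  then consider "i < j" | "j' < i'"
    using assms by linarith
  then show False
  proof cases
    case 1
    then have "Suc i \<in> {min i j<..max i j}" by auto
    with sparse assms(1) show False unfolding unseparated_def by blast
  next
    case 2
    then have "i' \<in> {min i' j'<..max i' j'}" by auto
    with sparse assms(3) show False unfolding unseparated_def by blast
  qed
qed

lemma inj_on_rank:
  "inj_on (\<lambda>(i, j). (rank i, rank j)) {(i, j). i \<noteq> j \<and> unseparated i j}"
proof (rule inj_onI, clarify)
  fix i j i' j'
  assume *: "i \<noteq> j" "unseparated i j" "i' \<noteq> j'" "unseparated i' j'"
    "rank i = rank i'" "rank j = rank j'"
  have "\<not> i < i'" "\<not> i' < i" "\<not> j < j'" "\<not> j' < j"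
    by (metis * unseparated_rank_inj unseparated_sym)+
  then show "i = i' \<and> j = j'" by auto
qed

text \<open>\<open>rank\<close> identifies the last vertex of a block with the first vertex of the next one, so a pair of
  distinct unseparated vertices is still determined by its ranks.\<close>

lemma card_unseparated_le:
  assumes "l < h"
  shows "card {(i, j). i \<in> {l..<h} \<and> j \<in> {l..<h} \<and> i \<noteq> j \<and> unseparated i j}
    \<le> (rank (h - 1) - rank l + 1)\<^sup>2" (is "card ?A \<le> _")
proof -
  let ?R = "{rank l..rank (h - 1)}"
  have "card ?A \<le> card (?R \<times> ?R)"
  proof (rule card_inj_on_le)
    show "inj_on (\<lambda>(i, j). (rank i, rank j)) ?A"
      by (rule inj_on_subset[OF inj_on_rank]) auto
    show "(\<lambda>(i, j). (rank i, rank j)) ` ?A \<subseteq> ?R \<times> ?R"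
      by (auto intro!: rank_mono)
  qed simp
  also have "\<dots> = (rank (h - 1) - rank l + 1)\<^sup>2"
    using rank_mono[of l "h - 1"] assms by (simp add: card_cartesian_product power2_eq_square Suc_diff_le)
  finally show ?thesis .
qed

text \<open>An edge with an endpoint in \<open>{l..<h}\<close> either crosses a sparse cut or joins
  two unseparated vertices. The latter are counted by ranks; the former number at most 2 K per cut,
  over fewer than n cuts.\<close>

lemma vol_sparse_le:
  assumes "0 \<le> K" "l < h" "h \<le> n" "l = 0 \<or> l \<in> sparse_cuts" "h = n \<or> h \<in> sparse_cuts"
  shows "real (vol l h) \<le> (real (rank (h - 1) - rank l) + 1)\<^sup>2 + 2 * K * n"
proof -
  let ?U = "{(i, j). i \<in> {l..<h} \<and> j \<in> {l..<h} \<and> i \<noteq> j \<and> unseparated i j}"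
  \<comment> \<open>Both orientations are needed since \<open>vol\<close> counts ordered
    pairs.\<close>
  let ?S = "\<Union>k\<in>sparse_cuts. cut k \<union> prod.swap ` cut k"
  have "{(i, j). i \<in> {l..<h} \<and> j < n \<and> E i j} \<subseteq> ?U \<union> ?S"
  proof
    fix e
    assume e: "e \<in> {(i, j). i \<in> {l..<h} \<and> j < n \<and> E i j}"
    show "e \<in> ?U \<union> ?S"
    proof (rule UnCI)
      assume "e \<notin> ?S"
      with e obtain i j where ij: "e = (i, j)" and
        *: "i \<in> {l..<h}" "j < n" "E i j" "(i, j) \<notin> ?S" by blast
      have sep: "\<not> (i < k \<and> k \<le> j)" "\<not> (j < k \<and> k \<le> i)" if "k \<in> sparse_cuts" for k
        using * that edge_sym by (force simp: cut_def)+
      \<comment> \<open>Leaving the interval would mean crossing its boundary l or h, which is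
        either an end of the vertex range or itself a sparse cut.\<close>
      have "j \<in> {l..<h}"
        using assms(4,5) *(1,2) sep[of l] sep[of h] by auto
      moreover have "unseparated i j"
        using sep unfolding unseparated_def min_def max_def by (auto split: if_splits)
      ultimately show "e \<in> ?U"
        using * edge_irrefl ij by auto
    qed
  qed
  then have "vol l h \<le> card (?U \<union> ?S)"
    unfolding vol_eq_card using finite_sparse_cuts finite_cut
    by (intro card_mono finite_UnI finite_UN_I finite_imageI)
      (auto intro: finite_subset[of _ "{..<h} \<times> {..<h}"])
  also have "\<dots> \<le> card ?U + card ?S"
    by (rule card_Un_le)
  finally have "real (vol l h) \<le> real (card ?U) + real (card ?S)"
    by linarith
  moreover have "real (card ?U) \<le> (real (rank (h - 1) - rank l) + 1)\<^sup>2"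
    using of_nat_mono[OF card_unseparated_le[OF \<open>l < h\<close>], where 'a = real] by (simp add: add.commute)
  moreover have "real (card ?S) \<le> 2 * K * n"
  proof -
    have "card ?S \<le> (\<Sum>k\<in>sparse_cuts. card (cut k \<union> prod.swap ` cut k))"
      by (rule card_UN_le[OF finite_sparse_cuts])
    then have "real (card ?S) \<le> (\<Sum>k\<in>sparse_cuts. real (card (cut k \<union> prod.swap ` cut k)))"
      by (simp flip: of_nat_sum)
    also have "\<dots> \<le> (\<Sum>k\<in>sparse_cuts. 2 * K)"
    proof (rule sum_mono)
      fix k assume k: "k \<in> sparse_cuts"
      have "card (cut k \<union> prod.swap ` cut k) \<le> card (cut k) + card (cut k)"
        using card_Un_le[of "cut k"] card_image_le[OF finite_cut, of prod.swap k]
        by (meson add_left_mono order_trans)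
      with k show "real (card (cut k \<union> prod.swap ` cut k)) \<le> 2 * K"
        by (auto simp: sparse_cuts_def)
    qed
    also have "\<dots> \<le> 2 * K * n"
      using card_mono[OF _ sparse_cuts_subset] assms(1) by (simp add: mult.commute mult_left_mono)
    finally show ?thesis .
  qed
  ultimately show ?thesis by linarith
qed

text \<open>The side volumes are at most squares of p + \<delta> and q + \<delta>, where p and q are
  the rank lengths of the two sides and p + q = n - 1 - G. The harmonic mean estimate makes the
  bound independent of where the cut lies.\<close>

lemma vol_prod_sparse_le:
  fixes \<delta> :: real
  assumes "0 \<le> K" "1 + sqrt (2 * K * n) \<le> \<delta>" "k \<in> sparse_cuts"
  shows "real (vol 0 k) * real (vol k n) / real (vol 0 n)
    \<le> (real n - real (card sparse_cuts) + 2 * \<delta>)\<^sup>2 / 8"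
proof -
  have k: "0 < k" "k < n" using assms(3) sparse_cuts_subset by auto
  \<comment> \<open>The crossing edges are absorbed into the square by enlarging its base, because
    the harmonic mean estimate wants pure squares.\<close>
  have sq: "(a + 1)\<^sup>2 + 2 * K * n \<le> (a + \<delta>)\<^sup>2" if "0 \<le> a" for a :: real
  proof -
    have "(a + 1)\<^sup>2 + (sqrt (2 * K * n))\<^sup>2 \<le> (a + 1 + sqrt (2 * K * n))\<^sup>2"
      using that assms(1) by (simp add: power2_sum)
    also have "\<dots> \<le> (a + \<delta>)\<^sup>2"
      using that assms by (intro power_mono) auto
    finally show ?thesis using assms(1) by simp
  qed
  have "0 \<le> sqrt (2 * K * n)" using assms(1) by simp
  with assms(2) have \<delta>: "0 \<le> \<delta>" by linarith
  define p where "p = rank (k - 1) - rank 0"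
  define q where "q = rank (n - 1) - rank k"
  have p: "real (vol 0 k) \<le> (real p + \<delta>)\<^sup>2"
    unfolding p_def using vol_sparse_le[of 0 k] sq assms k by (meson of_nat_0_le_iff order_trans less_imp_le)
  have q: "real (vol k n) \<le> (real q + \<delta>)\<^sup>2"
    unfolding q_def using vol_sparse_le[of k n] sq assms k by (meson of_nat_0_le_iff order_trans order_refl)
  \<comment> \<open>Cut k is sparse and adds no rank, so the rank lengths of the two sides add up
    exactly.\<close>
  have "rank k = rank (k - 1)"
  proof -
    have "{k - 1<..k} = {k}" using k by auto
    then have "{k - 1<..k} - sparse_cuts = {}" using assms(3) by simp
    then show ?thesis using rank_split[of "k - 1" k] by simp
  qed
  moreover have "rank 0 = 0" by (simp add: rank_def)
  moreover have "rank k \<le> rank (n - 1)" using k by (intro rank_mono) auto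
  moreover have "rank (n - 1) + card sparse_cuts = n - 1"
  proof -
    have "{1..n-1} = {1..<n}" using k by auto
    then show ?thesis
      using card_mono[OF _ sparse_cuts_subset] card_Diff_subset[OF finite_sparse_cuts sparse_cuts_subset]
      unfolding rank_def by simp
  qed
  ultimately have pq: "p + q + card sparse_cuts = n - 1" by (simp add: p_def q_def)
  have "vol 0 n = vol 0 k + vol k n" using vol_add[of 0 k n] k by simp
  then have "real (vol 0 k) * real (vol k n) / real (vol 0 n)
      \<le> (real p + \<delta> + (real q + \<delta>))\<^sup>2 / 8"
    using mult_div_add_le_eighth_square[OF _ _ _ p q] vol_pos[OF k] \<delta> by simp
  also have "\<dots> \<le> (real n - real (card sparse_cuts) + 2 * \<delta>)\<^sup>2 / 8"
  proof (intro divide_right_mono power_mono)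
    have "real p + real q + real (card sparse_cuts) \<le> real n"
      using pq by linarith
    then show "real p + \<delta> + (real q + \<delta>) \<le> real n - real (card sparse_cuts) + 2 * \<delta>"
      by linarith
  qed (use \<delta> in auto)
  finally show ?thesis .
qed

text \<open>At a sparse cut the divisor is only known to be at least 1, but the previous estimate
  applies. At any other cut the volume quotient is at most the total volume, hence at most
  \<open>n\<^sup>2\<close>, and the divisor exceeds K.\<close>

lemma sum_vol_prod_le:
  fixes \<delta> :: real
  assumes "0 < K" "1 + sqrt (2 * K * n) \<le> \<delta>"
  shows "(\<Sum>k\<in>{1..<n}. real (vol 0 k) * real (vol k n) / real (vol 0 n) / real (card (cut k)))
    \<le> (real n + 2 * \<delta>) ^ 3 / 54 + real n ^ 3 / K"
proof -
  let ?t = "\<lambda>k. real (vol 0 k) * real (vol k n) / real (vol 0 n) / real (card (cut k))"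
  let ?G = "real (card sparse_cuts)"
  let ?N = "real n + 2 * \<delta>"
  have G: "card sparse_cuts \<le> n"
    using card_mono[OF _ sparse_cuts_subset] by simp
  have "0 \<le> sqrt (2 * K * n)" using assms(1) by simp
  with assms(2) have \<delta>: "0 \<le> \<delta>" by linarith
  have "(\<Sum>k\<in>sparse_cuts. ?t k) \<le> (\<Sum>k\<in>sparse_cuts. (?N - ?G)\<^sup>2 / 8)"
  proof (rule sum_mono)
    fix k assume k: "k \<in> sparse_cuts"
    then have "1 \<le> card (cut k)" using card_cut_pos[of k] sparse_cuts_subset by auto
    then have "?t k \<le> real (vol 0 k) * real (vol k n) / real (vol 0 n)"
      using divide_left_mono[of 1 "real (card (cut k))"
          "real (vol 0 k) * real (vol k n) / real (vol 0 n)"] by simp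
    also have "\<dots> \<le> (?N - ?G)\<^sup>2 / 8"
      using vol_prod_sparse_le[OF _ assms(2) k] assms(1) by (simp add: algebra_simps)
    finally show "?t k \<le> (?N - ?G)\<^sup>2 / 8" .
  qed
  also have "\<dots> = ?G * (?N - ?G)\<^sup>2 / 8" by simp
  \<comment> \<open>The worst number of sparse cuts is a third of N, matching a path through a third
    of the vertices.\<close>
  also have "\<dots> \<le> (4 * ?N ^ 3 / 27) / 8"
    using G \<delta> by (intro divide_right_mono mult_square_le_cube) auto
  finally have sparse: "(\<Sum>k\<in>sparse_cuts. ?t k) \<le> ?N ^ 3 / 54" by simp
  have "(\<Sum>k\<in>{1..<n} - sparse_cuts. ?t k) \<le> (\<Sum>k\<in>{1..<n} - sparse_cuts. real n ^ 2 / K)"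
  proof (rule sum_mono)
    fix k assume "k \<in> {1..<n} - sparse_cuts"
    then have k: "0 < k" "k < n" and c: "K < card (cut k)" by (auto simp: sparse_cuts_def)
    have add: "vol 0 k + vol k n = vol 0 n" using vol_add[of 0 k n] k by simp
    have "real (vol 0 k) * real (vol k n) \<le> real (vol 0 n) * real (vol 0 n)"
      using add by (intro mult_mono) auto
    then have "real (vol 0 k) * real (vol k n) / real (vol 0 n) \<le> real (vol 0 n)"
      using vol_pos[OF k] add by (simp add: divide_simps)
    also have "\<dots> \<le> real n ^ 2"
      using vol_le by (simp flip: of_nat_power)
    finally show "?t k \<le> real n ^ 2 / K"
      using c assms(1) by (intro frac_le) auto
  qed
  also have "\<dots> \<le> real n * (real n ^ 2 / K)"
  proof -
    have "card ({1..<n} - sparse_cuts) \<le> n"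
      using card_mono[of "{1..<n}" "{1..<n} - sparse_cuts"] by auto
    then show ?thesis using assms(1) by (simp add: divide_right_mono mult_right_mono)
  qed
  also have "\<dots> = real n ^ 3 / K" by (simp add: power2_eq_square power3_eq_cube)
  finally show ?thesis
    using sparse sum.subset_diff[OF sparse_cuts_subset, of ?t] by simp
qed

end

section \<open>Energy of a monotone function on an ordered graph\<close>

definition edge_energy :: "(nat \<Rightarrow> real) \<Rightarrow> real" where
  "edge_energy f = (\<Sum>(i, j) | i < j \<and> E i j. (f j - f i)\<^sup>2)"

lemma edge_energy_nonneg: "0 \<le> edge_energy f"
  by (simp add: edge_energy_def sum_nonneg case_prod_unfold)

lemma finite_pairs: "finite {(i, j). i < j \<and> E i j}"
  by (rule finite_subset[OF _ finite_edges[of "\<lambda>i j. i < j"]]) auto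

text \<open>The edge from i to j crosses exactly the cuts in \<open>{i<..j}\<close>. Regrouped by
  edges, the left side has for each edge the squared gaps of f along it; the gaps are nonnegative,
  so their squares sum to at most the square of their sum.\<close>

lemma cut_energy_le:
  assumes mono: "\<And>i j. i \<le> j \<Longrightarrow> j < n \<Longrightarrow> f i \<le> f j"
  shows "(\<Sum>k\<in>{1..<n}. real (card (cut k)) * (f k - f (k - 1))\<^sup>2) \<le> edge_energy f"
proof -
  let ?P = "{(i, j). i < j \<and> E i j}"
  let ?g = "\<lambda>k. (f k - f (k - 1))\<^sup>2"
  have "real (card (cut k)) * ?g k = (\<Sum>e\<in>?P. if fst e < k \<and> k \<le> snd e then ?g k else 0)" for k
  proof -
    have "cut k = {e \<in> ?P. fst e < k \<and> k \<le> snd e}"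
      by (auto simp: cut_def)
    then show ?thesis
      using finite_pairs by (simp add: sum.If_cases Collect_conj_eq)
  qed
  then have "(\<Sum>k\<in>{1..<n}. real (card (cut k)) * ?g k)
      = (\<Sum>e\<in>?P. \<Sum>k\<in>{1..<n}. if fst e < k \<and> k \<le> snd e then ?g k else 0)"
    by (simp add: sum.swap[of _ ?P])
  also have "\<dots> \<le> (\<Sum>e\<in>?P. (f (snd e) - f (fst e))\<^sup>2)"
  proof (rule sum_mono)
    fix e assume "e \<in> ?P"
    then have e: "fst e < snd e" "snd e < n" using edge_less by auto
    then have "{1..<n} \<inter> {k. fst e < k \<and> k \<le> snd e} = {fst e<..snd e}" by auto
    then have "(\<Sum>k\<in>{1..<n}. if fst e < k \<and> k \<le> snd e then ?g k else 0)
        = (\<Sum>k\<in>{fst e<..snd e}. ?g k)"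
      by (simp add: sum.If_cases)
    also have "\<dots> \<le> (\<Sum>k\<in>{fst e<..snd e}. f k - f (k - 1))\<^sup>2"
      using e by (intro sum_squares_le_square_sum) (auto intro!: mono)
    also have "(\<Sum>k\<in>{fst e<..snd e}. f k - f (k - 1)) = f (snd e) - f (fst e)"
      using sum_telescope_gaps e by simp
    finally show "(\<Sum>k\<in>{1..<n}. if fst e < k \<and> k \<le> snd e then ?g k else 0)
        \<le> (f (snd e) - f (fst e))\<^sup>2" .
  qed
  also have "\<dots> = edge_energy f"
    by (simp add: edge_energy_def case_prod_unfold)
  finally show ?thesis .
qed

text \<open>The difference telescopes into gaps, and Cauchy-Schwarz is weighted by the cut sizes.
  The last factor is the series resistance from i to j of a path whose conductances are the cut
  sizes.\<close>

lemma square_diff_le: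
  assumes mono: "\<And>i j. i \<le> j \<Longrightarrow> j < n \<Longrightarrow> f i \<le> f j"
    and ij: "i < j" "j < n"
  shows "(f j - f i)\<^sup>2 \<le> edge_energy f * (\<Sum>k\<in>{i<..j}. 1 / real (card (cut k)))"
proof -
  let ?c = "\<lambda>k. real (card (cut k))"
  let ?g = "\<lambda>k. f k - f (k - 1)"
  have "(f j - f i)\<^sup>2 = (\<Sum>k\<in>{i<..j}. ?g k)\<^sup>2"
    using sum_telescope_gaps ij by simp
  also have "\<dots> \<le> (\<Sum>k\<in>{i<..j}. ?c k * (?g k)\<^sup>2) * (\<Sum>k\<in>{i<..j}. 1 / ?c k)"
    using ij card_cut_pos by (intro weighted_Cauchy_Schwarz) auto
  also have "\<dots> \<le> edge_energy f * (\<Sum>k\<in>{i<..j}. 1 / ?c k)"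
  proof (intro mult_right_mono sum_nonneg)
    have "(\<Sum>k\<in>{i<..j}. ?c k * (?g k)\<^sup>2) \<le> (\<Sum>k\<in>{1..<n}. ?c k * (?g k)\<^sup>2)"
      using ij by (intro sum_mono2) auto
    with cut_energy_le[of f, OF mono] show "(\<Sum>k\<in>{i<..j}. ?c k * (?g k)\<^sup>2) \<le> edge_energy f"
      by linarith
  qed auto
  finally show ?thesis .
qed

text \<open>The variance identity reduces to pairs, each pair is bounded by the resistance between
  its members, and exchanging the sums collects the volume product at each cut.\<close>

lemma weighted_variance_le:
  fixes \<delta> K :: real
  assumes mono: "\<And>i j. i \<le> j \<Longrightarrow> j < n \<Longrightarrow> f i \<le> f j"
    and mean: "(\<Sum>i<n. real (degree n E i) * f i) = 0"
    and K: "0 < K" "1 + sqrt (2 * K * n) \<le> \<delta>"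
    and n: "2 \<le> n"
  shows "(\<Sum>i<n. real (degree n E i) * (f i)\<^sup>2)
    \<le> ((real n + 2 * \<delta>) ^ 3 / 54 + real n ^ 3 / K) * edge_energy f"
proof -
  let ?d = "\<lambda>i. real (degree n E i)"
  let ?c = "\<lambda>k. real (card (cut k))"
  let ?M = "real (vol 0 n)"
  let ?P = "{(i, j). i < j \<and> j < n}"
  have M: "0 < ?M" using vol_pos[of 1] vol_add[of 0 1 n] n by simp
  have Md: "?M = (\<Sum>i<n. ?d i)" by (simp add: vol_def lessThan_atLeast0)
  have "?M * (\<Sum>i<n. ?d i * (f i)\<^sup>2) = (\<Sum>(i, j)\<in>?P. ?d i * ?d j * (f j - f i)\<^sup>2)"
    using weighted_variance_identity[of ?d f n] mean by (simp add: Md)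
  also have "\<dots> \<le> (\<Sum>(i, j)\<in>?P. ?d i * ?d j * (edge_energy f * (\<Sum>k\<in>{i<..j}. 1 / ?c k)))"
    using square_diff_le[of f, OF mono] by (intro sum_mono) (auto intro!: mult_left_mono)
  also have "\<dots> = edge_energy f * (\<Sum>(i, j)\<in>?P. ?d i * ?d j * (\<Sum>k\<in>{i<..j}. 1 / ?c k))"
    by (simp add: sum_distrib_left case_prod_unfold algebra_simps)
  also have "(\<Sum>(i, j)\<in>?P. ?d i * ?d j * (\<Sum>k\<in>{i<..j}. 1 / ?c k))
      = (\<Sum>k\<in>{1..<n}. real (vol 0 k) * real (vol k n) / ?c k)"
    using sum_pairs_swap[of ?d "\<lambda>k. 1 / ?c k" n] by (simp add: vol_def lessThan_atLeast0)
  finally have "?M * (\<Sum>i<n. ?d i * (f i)\<^sup>2)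
      \<le> edge_energy f * (\<Sum>k\<in>{1..<n}. real (vol 0 k) * real (vol k n) / ?c k)" .
  then have "(\<Sum>i<n. ?d i * (f i)\<^sup>2)
      \<le> edge_energy f * (\<Sum>k\<in>{1..<n}. real (vol 0 k) * real (vol k n) / ?c k) / ?M"
    using M by (simp add: pos_le_divide_eq mult.commute)
  also have "\<dots> = edge_energy f * (\<Sum>k\<in>{1..<n}. real (vol 0 k) * real (vol k n) / ?M / ?c k)"
    by (simp add: sum_divide_distrib mult.commute flip: times_divide_eq_right)
  also have "\<dots> \<le> edge_energy f * ((real n + 2 * \<delta>) ^ 3 / 54 + real n ^ 3 / K)"
    by (rule mult_left_mono[OF sum_vol_prod_le[OF K] edge_energy_nonneg])
  finally show ?thesis by (simp add: mult.commute)
qed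

end

section \<open>The second smallest eigenvalue of a real symmetric matrix\<close>

lemma scalar_prod_self_pos:
  fixes x :: "real vec"
  assumes "x \<in> carrier_vec n" "x \<noteq> 0\<^sub>v n"
  shows "0 < x \<bullet> x"
proof -
  obtain i where i: "i < n" "x $ i \<noteq> 0"
    using assms by (metis carrier_vecD eq_vecI index_zero_vec)
  have "0 < (\<Sum>i\<in>{0..<n}. x $ i * x $ i)"
    using i by (intro sum_pos2[of _ i]) (auto simp: zero_less_mult_iff linorder_neq_iff)
  then show ?thesis using assms by (simp add: scalar_prod_def)
qed

lemma scalar_prod_symmetric_mat:
  fixes A :: "real mat"
  assumes "A \<in> carrier_mat n n" "A\<^sup>T = A" "x \<in> carrier_vec n" "y \<in> carrier_vec n"
  shows "x \<bullet> (A *\<^sub>v y) = y \<bullet> (A *\<^sub>v x)"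
proof -
  have "x \<bullet> (A *\<^sub>v y) = (A *\<^sub>v x) \<bullet> y"
    using transpose_vec_mult_scalar[of A n n y x] assms by simp
  also have "\<dots> = y \<bullet> (A *\<^sub>v x)"
    using assms by (intro comm_scalar_prod[of _ n]) auto
  finally show ?thesis .
qed

text \<open>If \<open>x + i y\<close> is a complex eigenvector for \<open>r + i s\<close>, symmetry of \<open>A\<close> applied to \<open>x\<close> and \<open>y\<close>
  gives \<open>s (|x|\<^sup>2 + |y|\<^sup>2) = 0\<close>.\<close>

lemma symmetric_mat_eigenvector_exists:
  fixes A :: "real mat"
  assumes A: "A \<in> carrier_mat n n" and sym: "A\<^sup>T = A" and "0 < n"
  obtains l v where "v \<in> carrier_vec n" "v \<noteq> 0\<^sub>v n" "A *\<^sub>v v = l \<cdot>\<^sub>v v"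
proof -
  let ?B = "map_mat complex_of_real A"
  have B: "?B \<in> carrier_mat n n" using A by simp
  obtain as where as: "char_poly ?B = (\<Prod>a\<leftarrow>as. [:- a, 1:])" "length as = n"
    using char_poly_factorized[OF B] by blast
  then obtain a where a: "a \<in> set as" using \<open>0 < n\<close> by (cases as) auto
  then have "poly (char_poly ?B) a = 0"
    unfolding as(1) by (induction as) auto
  then have "eigenvalue ?B a"
    using eigenvalue_root_char_poly[OF B] by simp
  then obtain w where w: "w \<in> carrier_vec n" "w \<noteq> 0\<^sub>v n" "?B *\<^sub>v w = a \<cdot>\<^sub>v w"
    using B unfolding eigenvalue_def eigenvector_def by auto
  define x where "x = map_vec Re w"
  define y where "y = map_vec Im w"
  have xy: "x \<in> carrier_vec n" "y \<in> carrier_vec n" using w by (auto simp: x_def y_def)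
  have entry: "(\<Sum>j\<in>{0..<n}. complex_of_real (A $$ (i, j)) * w $ j) = a * w $ i" if "i < n" for i
    using arg_cong[OF w(3), of "\<lambda>v. v $ i"] A w(1) that by (simp add: scalar_prod_def)
  have Ax: "A *\<^sub>v x = Re a \<cdot>\<^sub>v x - Im a \<cdot>\<^sub>v y"
  proof (rule eq_vecI)
    fix i assume "i < dim_vec (Re a \<cdot>\<^sub>v x - Im a \<cdot>\<^sub>v y)"
    then have "i < n" using xy by simp
    then show "(A *\<^sub>v x) $ i = (Re a \<cdot>\<^sub>v x - Im a \<cdot>\<^sub>v y) $ i"
      using arg_cong[OF entry, of i Re] A w(1) xy by (simp add: scalar_prod_def x_def y_def)
  qed (use A xy in auto)
  have Ay: "A *\<^sub>v y = Re a \<cdot>\<^sub>v y + Im a \<cdot>\<^sub>v x"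
  proof (rule eq_vecI)
    fix i assume "i < dim_vec (Re a \<cdot>\<^sub>v y + Im a \<cdot>\<^sub>v x)"
    then have "i < n" using xy by simp
    then show "(A *\<^sub>v y) $ i = (Re a \<cdot>\<^sub>v y + Im a \<cdot>\<^sub>v x) $ i"
      using arg_cong[OF entry, of i Im] A w(1) xy by (simp add: scalar_prod_def x_def y_def)
  qed (use A xy in auto)
  have nz: "x \<noteq> 0\<^sub>v n \<or> y \<noteq> 0\<^sub>v n"
  proof (rule ccontr)
    assume "\<not> ?thesis"
    then have *: "x = 0\<^sub>v n" "y = 0\<^sub>v n" by auto
    have "w = 0\<^sub>v n"
    proof (rule eq_vecI)
      fix i assume i: "i < dim_vec (0\<^sub>v n :: complex vec)"
      then show "w $ i = 0\<^sub>v n $ i"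
        using arg_cong[OF *(1), of "\<lambda>v. v $ i"] arg_cong[OF *(2), of "\<lambda>v. v $ i"] w(1)
        by (simp add: x_def y_def complex_eq_iff)
    qed (use w in auto)
    with w(2) show False by simp
  qed
  have "Im a * (x \<bullet> x + y \<bullet> y) = 0"
    using scalar_prod_symmetric_mat[OF A sym xy] xy comm_scalar_prod[OF xy] unfolding Ax Ay
    by (simp add: scalar_prod_add_distrib[of _ n] scalar_prod_minus_distrib[of _ n] algebra_simps)
  moreover have "0 < x \<bullet> x + y \<bullet> y"
    using nz xy scalar_prod_self_pos[of x n] scalar_prod_self_pos[of y n]
    by (cases "x = 0\<^sub>v n"; cases "y = 0\<^sub>v n") auto
  ultimately have "Im a = 0" by simp
  then have "A *\<^sub>v x = Re a \<cdot>\<^sub>v x" "A *\<^sub>v y = Re a \<cdot>\<^sub>v y"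
    unfolding Ax Ay using xy by (auto intro!: eq_vecI)
  with nz xy that show thesis by blast
qed

text \<open>Householder reflection in the hyperplane orthogonal to w = v -
  \<open>unit_vec n 0\<close>. It exchanges the two unit vectors; the degenerate case w = 0 is
  served by the identity.\<close>

lemma reflection_exists:
  fixes v :: "real vec"
  assumes v: "v \<in> carrier_vec n" "v \<bullet> v = 1" and "0 < n"
  obtains H where "H \<in> carrier_mat n n" "H\<^sup>T = H" "H * H = 1\<^sub>m n" "H *\<^sub>v unit_vec n 0 = v"
proof (cases "v = unit_vec n 0")
  case True
  then show thesis by (intro that[of "1\<^sub>m n"]) auto
next
  case False
  define w where "w = v - unit_vec n 0"
  have w: "w \<in> carrier_vec n" using v by (simp add: w_def)
  have "w \<noteq> 0\<^sub>v n"
  proof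
    assume "w = 0\<^sub>v n"
    then have "w $ i = 0" if "i < n" for i
      using that by simp
    moreover have "w $ i = v $ i - unit_vec n 0 $ i" if "i < n" for i
      using that v by (simp add: w_def)
    ultimately have "v $ i = unit_vec n 0 $ i" if "i < n" for i
      using that by simp
    with False v show False by (metis carrier_vecD eq_vecI index_unit_vec(3))
  qed
  then have pos: "0 < w \<bullet> w" using scalar_prod_self_pos w by blast
  define c where "c = 2 / (w \<bullet> w)"
  have c: "c * (w \<bullet> w) = 2" using pos by (simp add: c_def)
  have w0: "w $ 0 = v $ 0 - 1" using \<open>0 < n\<close> v by (simp add: w_def)
  \<comment> \<open>Uses that v is a unit vector. It fixes \<open>c * w $ 0\<close> at -1, which
    makes column 0 of \<open>H\<close> equal to v.\<close>
  have "w \<bullet> w = 2 - 2 * v $ 0"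
    using v \<open>0 < n\<close> unfolding w_def
    by (simp add: scalar_prod_minus_distrib[of _ n] minus_scalar_prod_distrib[of _ n])
  then have "w \<bullet> w = - 2 * w $ 0" using w0 by simp
  with c have cw0: "c * w $ 0 = -1" by simp
  have ww: "(\<Sum>k\<in>{0..<n}. w $ k * w $ k) = w \<bullet> w" using w by (simp add: scalar_prod_def)
  define H where "H = mat n n (\<lambda>(i, j). (if i = j then 1 else 0) - c * w $ i * w $ j)"
  have H: "H \<in> carrier_mat n n" by (simp add: H_def)
  show thesis
  proof (rule that[of H])
    show "H \<in> carrier_mat n n" by (rule H)
    show "H\<^sup>T = H" by (rule eq_matI) (auto simp: H_def)
    show "H * H = 1\<^sub>m n"
    proof (rule eq_matI)
      fix i j assume "i < dim_row (1\<^sub>m n :: real mat)" "j < dim_col (1\<^sub>m n :: real mat)"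
      then have ij: "i < n" "j < n" by auto
      have "(H * H) $$ (i, j) = (\<Sum>k\<in>{0..<n}. ((if i = k then 1 else 0) - c * w $ i * w $ k)
          * ((if k = j then 1 else 0) - c * w $ k * w $ j))"
        using ij by (simp add: H_def scalar_prod_def)
      also have "\<dots> = (\<Sum>k\<in>{0..<n}. (if i = k then (if k = j then 1 else 0) - c * w $ k * w $ j else 0)
          - (if k = j then c * w $ i * w $ k else 0) + c * c * w $ i * w $ j * (w $ k * w $ k))"
        by (intro sum.cong) (auto simp: algebra_simps)
      also have "\<dots> = (if i = j then 1 else 0) - 2 * c * w $ i * w $ j
          + c * w $ i * w $ j * (c * (w \<bullet> w))"
        using ij by (simp add: sum.distrib sum_subtractf flip: sum_distrib_left ww)
      also have "\<dots> = 1\<^sub>m n $$ (i, j)" using ij by (simp add: c)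
      finally show "(H * H) $$ (i, j) = 1\<^sub>m n $$ (i, j)" .
    qed (auto simp: H_def)
    show "H *\<^sub>v unit_vec n 0 = v"
    proof (rule eq_vecI)
      fix i assume "i < dim_vec v"
      then have i: "i < n" using v by simp
      have "(H *\<^sub>v unit_vec n 0) $ i = H $$ (i, 0)"
        using i \<open>0 < n\<close> H by simp
      also have "\<dots> = (if i = 0 then 1 else 0) - c * w $ 0 * w $ i"
        using i \<open>0 < n\<close> by (simp add: H_def)
      also have "\<dots> = (if i = 0 then 1 else 0) + w $ i" unfolding cw0 by simp
      also have "\<dots> = v $ i" using i v by (auto simp: w_def unit_vec_def)
      finally show "(H *\<^sub>v unit_vec n 0) $ i = v $ i" .
    qed (use v H in auto)
  qed
qed

text \<open>Induction on the dimension: conjugation by a reflection taking the first basis vector to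
  a unit eigenvector clears the first column off the diagonal, and by symmetry also the first row.
  The remaining block is diagonalized by the induction hypothesis.\<close>

theorem symmetric_mat_diagonalization:
  fixes A :: "real mat"
  assumes "A \<in> carrier_mat n n" "A\<^sup>T = A"
  shows "\<exists>P D. P \<in> carrier_mat n n \<and> D \<in> carrier_mat n n \<and> diagonal_mat D
    \<and> P\<^sup>T * P = 1\<^sub>m n \<and> A = P * D * P\<^sup>T"
  using assms
proof (induction n arbitrary: A)
  case 0
  then show ?case
    by (intro exI[of _ "1\<^sub>m 0"]) (auto simp: diagonal_mat_def)
next
  case (Suc n)
  note A = Suc.prems
  obtain l u where u: "u \<in> carrier_vec (Suc n)" "u \<noteq> 0\<^sub>v (Suc n)" "A *\<^sub>v u = l \<cdot>\<^sub>v u"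
    using symmetric_mat_eigenvector_exists[OF A zero_less_Suc] by blast
  define v where "v = (1 / sqrt (u \<bullet> u)) \<cdot>\<^sub>v u"
  have pos: "0 < u \<bullet> u" using u scalar_prod_self_pos by blast
  have v: "v \<in> carrier_vec (Suc n)" "v \<bullet> v = 1"
    using u(1) pos by (auto simp: v_def)
  have Av: "A *\<^sub>v v = l \<cdot>\<^sub>v v"
    unfolding v_def mult_mat_vec[OF A(1) u(1)] u(3) by (simp add: smult_smult_assoc mult.commute)
  obtain H where H: "H \<in> carrier_mat (Suc n) (Suc n)" "H\<^sup>T = H" "H * H = 1\<^sub>m (Suc n)"
    "H *\<^sub>v unit_vec (Suc n) 0 = v"
    using reflection_exists[OF v] by auto
  let ?e = "unit_vec (Suc n) 0 :: real vec"
  define B where "B = H * A * H"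
  have B: "B \<in> carrier_mat (Suc n) (Suc n)" using H A by (simp add: B_def)
  have Hv: "H *\<^sub>v v = ?e"
  proof -
    have "H *\<^sub>v v = (H * H) *\<^sub>v ?e"
      unfolding H(4)[symmetric] using H(1) by (intro assoc_mult_mat_vec[symmetric]) auto
    then show ?thesis using H(3) by simp
  qed
  have "B *\<^sub>v ?e = (H * A) *\<^sub>v v"
    unfolding B_def H(4)[symmetric] using H(1) A(1) by (intro assoc_mult_mat_vec) auto
  also have "\<dots> = H *\<^sub>v (A *\<^sub>v v)"
    using H(1) A(1) v(1) by (intro assoc_mult_mat_vec) auto
  also have "\<dots> = l \<cdot>\<^sub>v ?e"
    using H(1) v(1) by (simp add: Av mult_mat_vec Hv)
  finally have Be: "B *\<^sub>v ?e = l \<cdot>\<^sub>v ?e" .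
  have col0: "B $$ (i, 0) = (if i = 0 then l else 0)" if "i < Suc n" for i
  proof -
    have "(B *\<^sub>v ?e) $ i = B $$ (i, 0)" using B that by simp
    then show ?thesis unfolding Be using that by (cases "i = 0") auto
  qed
  have symB: "B\<^sup>T = B"
  proof -
    have "B\<^sup>T = H\<^sup>T * (H * A)\<^sup>T"
      unfolding B_def using H A by (intro transpose_mult) auto
    also have "(H * A)\<^sup>T = A\<^sup>T * H\<^sup>T"
      using H A by (intro transpose_mult) auto
    finally show ?thesis using H A by (simp add: B_def assoc_mult_mat[of _ "Suc n" "Suc n" _ "Suc n" _ "Suc n"])
  qed
  have row0: "B $$ (0, j) = (if j = 0 then l else 0)" if "j < Suc n" for j
    using arg_cong[OF symB, of "\<lambda>M. M $$ (j, 0)"] col0[OF that] B that by simp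
  define C where "C = mat n n (\<lambda>(i, j). B $$ (Suc i, Suc j))"
  let ?l = "mat 1 1 (\<lambda>_. l)"
  have C: "C \<in> carrier_mat n n" by (simp add: C_def)
  have "C\<^sup>T = C"
  proof (rule eq_matI)
    fix i j assume "i < dim_row C" "j < dim_col C"
    then show "C\<^sup>T $$ (i, j) = C $$ (i, j)"
      using arg_cong[OF symB, of "\<lambda>M. M $$ (Suc i, Suc j)"] B by (simp add: C_def)
  qed (auto simp: C_def)
  with Suc.IH[OF C] obtain Q D where Q: "Q \<in> carrier_mat n n" "D \<in> carrier_mat n n" "diagonal_mat D"
    "Q\<^sup>T * Q = 1\<^sub>m n" "C = Q * D * Q\<^sup>T" by blast
  let ?Q = "four_block_mat (1\<^sub>m 1) (0\<^sub>m 1 n) (0\<^sub>m n 1) Q"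
  let ?D = "four_block_mat ?l (0\<^sub>m 1 n) (0\<^sub>m n 1) D"
  have B_block: "B = four_block_mat ?l (0\<^sub>m 1 n) (0\<^sub>m n 1) C"
    using B by (intro eq_matI) (auto simp: C_def col0 row0)
  have QT: "?Q\<^sup>T = four_block_mat (1\<^sub>m 1) (0\<^sub>m 1 n) (0\<^sub>m n 1) (Q\<^sup>T)"
    using Q by (subst transpose_four_block_mat) auto
  have "?Q\<^sup>T * ?Q = four_block_mat (1\<^sub>m 1) (0\<^sub>m 1 n) (0\<^sub>m n 1) (1\<^sub>m n)"
    unfolding QT using Q by (subst mult_four_block_mat[of _ 1 1 _ n _ n]) auto
  then have QQ: "?Q\<^sup>T * ?Q = 1\<^sub>m (Suc n)" by simp
  have "?Q * ?D * ?Q\<^sup>T = four_block_mat ?l (0\<^sub>m 1 n) (0\<^sub>m n 1) (Q * D) * ?Q\<^sup>T"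
    using Q by (subst mult_four_block_mat[of _ 1 1 _ n _ n]) auto
  also have "\<dots> = B"
    unfolding QT B_block Q(5) using Q(1-3) by (subst mult_four_block_mat[of _ 1 1 _ n _ n]) auto
  finally have QDQ: "?Q * ?D * ?Q\<^sup>T = B" .
  have carr: "?Q \<in> carrier_mat (Suc n) (Suc n)" "?D \<in> carrier_mat (Suc n) (Suc n)"
    using Q by (auto intro: four_block_carrier_mat[of _ 1 1 _ n n, simplified])
  have diag: "diagonal_mat ?D"
    using Q(2,3) by (auto simp: diagonal_mat_def)
  \<comment> \<open>\<open>F\<close> and \<open>G\<close> are the two block matrices; from here on
    only the properties recorded in \<open>FG\<close> matter.\<close>
  obtain F G where FG: "F \<in> carrier_mat (Suc n) (Suc n)" "G \<in> carrier_mat (Suc n) (Suc n)"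
    "diagonal_mat G" "F\<^sup>T * F = 1\<^sub>m (Suc n)" "F * G * F\<^sup>T = B"
    by (rule that[OF carr diag QQ QDQ])
  note assoc = assoc_mult_mat[of _ "Suc n" "Suc n" _ "Suc n" _ "Suc n"]
  have T: "(H * F)\<^sup>T = F\<^sup>T * H"
    using transpose_mult[OF H(1) FG(1)] H(2) by simp
  have "(H * F)\<^sup>T * (H * F) = F\<^sup>T * (H * H) * F"
    unfolding T using H(1) FG(1) by (simp add: assoc)
  also have "\<dots> = 1\<^sub>m (Suc n)"
    using H(3) FG(1,4) by simp
  finally have orth: "(H * F)\<^sup>T * (H * F) = 1\<^sub>m (Suc n)" .
  have "A = (H * H) * A * (H * H)" using H(3) A by simp
  also have "\<dots> = H * B * H" using H(1) A by (simp add: B_def assoc)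
  also have "\<dots> = H * F * G * (H * F)\<^sup>T"
    unfolding T FG(5)[symmetric] using H(1) FG(1,2) by (simp add: assoc)
  finally have "A = H * F * G * (H * F)\<^sup>T" .
  with H(1) FG(1-3) orth show ?case by (intro exI[of _ "H * F"] exI[of _ G]) simp
qed

lemma proots_prod_linear_factors:
  fixes as :: "'a::idom list"
  shows "proots (\<Prod>a\<leftarrow>as. [:- a, 1:]) = mset as"
proof (induction as)
  case (Cons a as)
  have "(\<Prod>a\<leftarrow>as. [:- a, 1:]) \<noteq> 0" by (auto simp: prod_list_zero_iff)
  then have "proots ([:- a, 1:] * (\<Prod>a\<leftarrow>as. [:- a, 1:]))
      = proots [:- a, 1:] + proots (\<Prod>a\<leftarrow>as. [:- a, 1:])"
    by (intro proots_mult) auto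
  then show ?case using Cons by (simp del: mult_pCons_left)
qed simp

lemma proots_char_poly_diagonal:
  fixes A P D :: "real mat"
  assumes "P \<in> carrier_mat n n" "D \<in> carrier_mat n n" "diagonal_mat D" "P\<^sup>T * P = 1\<^sub>m n" "A = P * D * P\<^sup>T"
  shows "proots (char_poly A) = mset (map (\<lambda>k. D $$ (k, k)) [0..<n])"
proof -
  have "P * P\<^sup>T = 1\<^sub>m n"
    using mat_mult_left_right_inverse[of "P\<^sup>T" n P] assms by simp
  then have "similar_mat A D"
    using assms by (intro similar_matI[of _ _ P "P\<^sup>T" n]) auto
  then have "char_poly A = char_poly D" by (rule char_poly_similar)
  also have "\<dots> = (\<Prod>a\<leftarrow>diag_mat D. [:- a, 1:])"
    using assms(2,3) by (intro char_poly_upper_triangular[of _ n]) (auto simp: diagonal_mat_def)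
  also have "proots \<dots> = mset (diag_mat D)"
    by (rule proots_prod_linear_factors)
  finally show ?thesis using assms(2) by (simp add: diag_mat_def)
qed

text \<open>The columns of P are an orthonormal eigenbasis, and \<open>P\<^sup>T *\<^sub>v x\<close>
  holds the coordinates of x in it. The eigenvalues \<open>e\<close> come in no particular
  order.\<close>

lemma symmetric_mat_spectral_form:
  fixes A :: "real mat"
  assumes "A \<in> carrier_mat n n" "A\<^sup>T = A"
  obtains P e where "P \<in> carrier_mat n n" "P\<^sup>T * P = 1\<^sub>m n" "P * P\<^sup>T = 1\<^sub>m n"
    "proots (char_poly A) = mset (map e [0..<n])"
    "\<And>x. x \<in> carrier_vec n \<Longrightarrow> x \<bullet> (A *\<^sub>v x) = (\<Sum>k<n. e k * ((P\<^sup>T *\<^sub>v x) $ k)\<^sup>2)"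
    "\<And>x. x \<in> carrier_vec n \<Longrightarrow> x \<bullet> x = (\<Sum>k<n. ((P\<^sup>T *\<^sub>v x) $ k)\<^sup>2)"
proof -
  obtain P D where P: "P \<in> carrier_mat n n" "D \<in> carrier_mat n n" "diagonal_mat D"
    "P\<^sup>T * P = 1\<^sub>m n" "A = P * D * P\<^sup>T"
    using symmetric_mat_diagonalization[OF assms] by blast
  have PT: "P * P\<^sup>T = 1\<^sub>m n"
    using mat_mult_left_right_inverse[of "P\<^sup>T" n P] P by simp
  have "x \<bullet> (A *\<^sub>v x) = (\<Sum>k<n. D $$ (k, k) * ((P\<^sup>T *\<^sub>v x) $ k)\<^sup>2)"
    and "x \<bullet> x = (\<Sum>k<n. ((P\<^sup>T *\<^sub>v x) $ k)\<^sup>2)" if x: "x \<in> carrier_vec n" for x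
  proof -
    define y where "y = P\<^sup>T *\<^sub>v x"
    have y: "y \<in> carrier_vec n" using P x by (simp add: y_def)
    have transfer: "x \<bullet> (P *\<^sub>v z) = y \<bullet> z" if "z \<in> carrier_vec n" for z
      using transpose_vec_mult_scalar[OF P(1) that x] by (simp add: y_def)
    have "A *\<^sub>v x = (P * D) *\<^sub>v y"
      unfolding P(5) y_def using P(1,2) x by (intro assoc_mult_mat_vec) auto
    also have "\<dots> = P *\<^sub>v (D *\<^sub>v y)"
      using P(1,2) y by (intro assoc_mult_mat_vec) auto
    finally have "A *\<^sub>v x = P *\<^sub>v (D *\<^sub>v y)" .
    then have "x \<bullet> (A *\<^sub>v x) = y \<bullet> (D *\<^sub>v y)"
      using transfer[of "D *\<^sub>v y"] P(2) y by simp
    moreover have "(D *\<^sub>v y) $ k = D $$ (k, k) * y $ k" if "k < n" for k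
    proof -
      have "(D *\<^sub>v y) $ k = (\<Sum>j\<in>{0..<n}. D $$ (k, j) * y $ j)"
        using P(2) y that by (simp add: scalar_prod_def)
      also have "\<dots> = (\<Sum>j\<in>{0..<n}. if j = k then D $$ (k, k) * y $ k else 0)"
        using P(2,3) that by (intro sum.cong) (auto simp: diagonal_mat_def)
      finally show ?thesis using that by simp
    qed
    ultimately show "x \<bullet> (A *\<^sub>v x) = (\<Sum>k<n. D $$ (k, k) * (y $ k)\<^sup>2)"
      using P(2) y by (simp add: scalar_prod_def power2_eq_square lessThan_atLeast0 algebra_simps)
    have "P *\<^sub>v y = x"
      unfolding y_def using assoc_mult_mat_vec[of P n n "P\<^sup>T" n x] P(1) x PT by simp
    then have "x \<bullet> x = y \<bullet> y" using transfer[OF y] by simp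
    then show "x \<bullet> x = (\<Sum>k<n. (y $ k)\<^sup>2)"
      using y by (simp add: scalar_prod_def power2_eq_square lessThan_atLeast0)
  qed
  with P PT proots_char_poly_diagonal[OF P] show thesis by (intro that) auto
qed

section \<open>Courant-Fischer bounds for the second smallest eigenvalue\<close>

text \<open>Indices of the two smallest eigenvalues, counted with multiplicity: \<open>k0\<close>
  and \<open>k1\<close> differ even if their values agree.\<close>

lemma second_smallest_index:
  fixes e :: "nat \<Rightarrow> 'a::linorder"
  assumes "2 \<le> n"
  obtains k0 k1 where "k0 < n" "k1 < n" "k0 \<noteq> k1" "e k0 \<le> e k1"
    "sorted_list_of_multiset (mset (map e [0..<n])) ! 1 = e k1"
    "\<And>k. k < n \<Longrightarrow> k \<noteq> k0 \<Longrightarrow> e k1 \<le> e k"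
proof -
  define p where "p = sort_key e [0..<n]"
  have p: "length p = n" "set p = {..<n}" "distinct p" "sorted (map e p)"
    by (auto simp: p_def)
  have "sort (map e [0..<n]) = map e p"
    using p(4) by (intro properties_for_sort) (simp_all add: p_def)
  then have s: "sorted_list_of_multiset (mset (map e [0..<n])) = map e p"
    by (simp only: sorted_list_of_multiset_mset)
  show thesis
  proof (rule that[of "p ! 0" "p ! 1"])
    show "p ! 0 < n" "p ! 1 < n"
      using p(1,2) assms nth_mem[of 0 p] nth_mem[of 1 p] by auto
    show "p ! 0 \<noteq> p ! 1"
      using p(1,3) assms by (simp add: nth_eq_iff_index_eq)
    show "e (p ! 0) \<le> e (p ! 1)"
      using sorted_nth_mono[OF p(4), of 0 1] p(1) assms by simp
    show "sorted_list_of_multiset (mset (map e [0..<n])) ! 1 = e (p ! 1)"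
      unfolding s using p(1) assms by simp
    fix k assume k: "k < n" "k \<noteq> p ! 0"
    then obtain i where i: "i < n" "p ! i = k" using p(1,2) by (metis in_set_conv_nth lessThan_iff)
    with k have "1 \<le> i" by (cases i) auto
    then show "e (p ! 1) \<le> e k"
      using sorted_nth_mono[OF p(4), of 1 i] p(1) i by simp
  qed
qed

text \<open>One linear equation in two unknowns has a nontrivial solution; this is the dimension
  count behind both bounds that follow.\<close>

lemma annihilating_combination:
  fixes s t :: real
  obtains a b :: real where "a * s + b * t = 0" "a \<noteq> 0 \<or> b \<noteq> 0"
  by (cases "s = 0 \<and> t = 0") (use that[of 1 0] that[of t "- s"] in auto)

text \<open>The plane spanned by u and w contains a nonzero vector without component along the
  lowest eigenvector. On it the form is at least the second eigenvalue times the norm. The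
  assumption \<open>pos\<close> makes u and w independent.\<close>

lemma second_eigenvalue_le:
  fixes A :: "real mat"
  assumes A: "A \<in> carrier_mat n n" "A\<^sup>T = A" and n: "2 \<le> n"
    and u: "u \<in> carrier_vec n" and w: "w \<in> carrier_vec n"
    and pos: "\<And>a b x. x = a \<cdot>\<^sub>v u + b \<cdot>\<^sub>v w \<Longrightarrow> a \<noteq> 0 \<or> b \<noteq> 0 \<Longrightarrow> 0 < x \<bullet> x"
    and le: "\<And>a b x. x = a \<cdot>\<^sub>v u + b \<cdot>\<^sub>v w \<Longrightarrow> x \<bullet> (A *\<^sub>v x) \<le> c * (x \<bullet> x)"
  shows "sorted_list_of_multiset (proots (char_poly A)) ! 1 \<le> c"
proof -
  obtain P e where P: "P \<in> carrier_mat n n" "P\<^sup>T * P = 1\<^sub>m n" "P * P\<^sup>T = 1\<^sub>m n"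
    and roots: "proots (char_poly A) = mset (map e [0..<n])"
    and form: "\<And>x. x \<in> carrier_vec n \<Longrightarrow> x \<bullet> (A *\<^sub>v x) = (\<Sum>k<n. e k * ((P\<^sup>T *\<^sub>v x) $ k)\<^sup>2)"
      "\<And>x. x \<in> carrier_vec n \<Longrightarrow> x \<bullet> x = (\<Sum>k<n. ((P\<^sup>T *\<^sub>v x) $ k)\<^sup>2)"
    using symmetric_mat_spectral_form[OF A] by blast
  obtain k0 k1 where k: "k0 < n" "k1 < n" "k0 \<noteq> k1" "e k0 \<le> e k1"
    and second: "sorted_list_of_multiset (mset (map e [0..<n])) ! 1 = e k1"
    and min: "\<And>k. k < n \<Longrightarrow> k \<noteq> k0 \<Longrightarrow> e k1 \<le> e k"
    by (rule second_smallest_index[OF n, of e]) (rule that)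
  obtain a b where ab: "a * (P\<^sup>T *\<^sub>v u) $ k0 + b * (P\<^sup>T *\<^sub>v w) $ k0 = 0" "a \<noteq> 0 \<or> b \<noteq> 0"
    using annihilating_combination by blast
  define x where "x = a \<cdot>\<^sub>v u + b \<cdot>\<^sub>v w"
  have x: "x \<in> carrier_vec n" using u w by (simp add: x_def)
  have "P\<^sup>T *\<^sub>v x = a \<cdot>\<^sub>v (P\<^sup>T *\<^sub>v u) + b \<cdot>\<^sub>v (P\<^sup>T *\<^sub>v w)"
    unfolding x_def using P(1) u w
    by (simp add: mult_add_distrib_mat_vec[of _ n n] mult_mat_vec[of _ n n])
  then have "(P\<^sup>T *\<^sub>v x) $ k0 = 0" using ab(1) P(1) u w k by simp
  then have "e k1 * ((P\<^sup>T *\<^sub>v x) $ k)\<^sup>2 \<le> e k * ((P\<^sup>T *\<^sub>v x) $ k)\<^sup>2" if "k < n" for k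
    using min[OF that] by (cases "k = k0") (simp_all add: mult_right_mono)
  then have "(\<Sum>k<n. e k1 * ((P\<^sup>T *\<^sub>v x) $ k)\<^sup>2) \<le> (\<Sum>k<n. e k * ((P\<^sup>T *\<^sub>v x) $ k)\<^sup>2)"
    by (intro sum_mono) simp
  then have "e k1 * (x \<bullet> x) \<le> c * (x \<bullet> x)"
    using form[OF x] le[OF x_def] by (simp flip: sum_distrib_left)
  then show ?thesis
    using pos[OF x_def ab(2)] unfolding roots second by simp
qed

text \<open>Dually, the span of the two lowest eigenvectors contains a nonzero vector orthogonal to
  u, and there the form is at most the second eigenvalue times the norm.\<close>

lemma second_eigenvalue_ge:
  fixes A :: "real mat"
  assumes A: "A \<in> carrier_mat n n" "A\<^sup>T = A" and n: "2 \<le> n"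
    and u: "u \<in> carrier_vec n"
    and ge: "\<And>x. x \<in> carrier_vec n \<Longrightarrow> x \<bullet> u = 0 \<Longrightarrow> c * (x \<bullet> x) \<le> x \<bullet> (A *\<^sub>v x)"
  shows "c \<le> sorted_list_of_multiset (proots (char_poly A)) ! 1"
proof -
  obtain P e where P: "P \<in> carrier_mat n n" "P\<^sup>T * P = 1\<^sub>m n" "P * P\<^sup>T = 1\<^sub>m n"
    and roots: "proots (char_poly A) = mset (map e [0..<n])"
    and form: "\<And>x. x \<in> carrier_vec n \<Longrightarrow> x \<bullet> (A *\<^sub>v x) = (\<Sum>k<n. e k * ((P\<^sup>T *\<^sub>v x) $ k)\<^sup>2)"
      "\<And>x. x \<in> carrier_vec n \<Longrightarrow> x \<bullet> x = (\<Sum>k<n. ((P\<^sup>T *\<^sub>v x) $ k)\<^sup>2)"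
    using symmetric_mat_spectral_form[OF A] by blast
  obtain k0 k1 where k: "k0 < n" "k1 < n" "k0 \<noteq> k1" "e k0 \<le> e k1"
    and second: "sorted_list_of_multiset (mset (map e [0..<n])) ! 1 = e k1"
    using second_smallest_index[OF n, of e] by blast
  obtain a b where ab: "a * (P\<^sup>T *\<^sub>v u) $ k0 + b * (P\<^sup>T *\<^sub>v u) $ k1 = 0" "a \<noteq> 0 \<or> b \<noteq> 0"
    using annihilating_combination by blast
  \<comment> \<open>Coordinates, in the eigenbasis, of the combination of the two lowest
    eigenvectors.\<close>
  define y where "y = vec n (\<lambda>k. if k = k0 then a else if k = k1 then b else 0)"
  define x where "x = P *\<^sub>v y"
  have y: "y \<in> carrier_vec n" by (simp add: y_def)
  have x: "x \<in> carrier_vec n" using P y by (simp add: x_def)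
  have sum_y: "(\<Sum>k<n. g k * y $ k) = g k0 * a + g k1 * b" for g
  proof -
    have "(\<Sum>k<n. g k * y $ k) = (\<Sum>k\<in>{k0, k1}. g k * y $ k)"
      using k by (intro sum.mono_neutral_right) (auto simp: y_def)
    then show ?thesis using k by (simp add: y_def)
  qed
  have Px: "P\<^sup>T *\<^sub>v x = y"
    unfolding x_def using assoc_mult_mat_vec[of "P\<^sup>T" n n P n y] P y by simp
  have "x \<bullet> u = (P\<^sup>T *\<^sub>v u) \<bullet> y"
    unfolding x_def using transpose_vec_mult_scalar[OF P(1) y u] comm_scalar_prod[of "P *\<^sub>v y" n u] P y u
    by simp
  also have "\<dots> = (\<Sum>k<n. (P\<^sup>T *\<^sub>v u) $ k * y $ k)"
    using y by (simp add: scalar_prod_def lessThan_atLeast0)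
  also have "\<dots> = 0" unfolding sum_y using ab(1) by (simp add: mult.commute)
  finally have "x \<bullet> u = 0" .
  then have "c * (x \<bullet> x) \<le> x \<bullet> (A *\<^sub>v x)" by (rule ge[OF x])
  moreover have "x \<bullet> x = a\<^sup>2 + b\<^sup>2"
    using sum_y[of "\<lambda>k. y $ k"] k unfolding form(2)[OF x] Px power2_eq_square by (simp add: y_def)
  moreover have "x \<bullet> (A *\<^sub>v x) = e k0 * a\<^sup>2 + e k1 * b\<^sup>2"
    using sum_y[of "\<lambda>k. e k * y $ k"] k unfolding form(1)[OF x] Px power2_eq_square
    by (simp add: y_def mult.assoc)
  moreover have "e k0 * a\<^sup>2 \<le> e k1 * a\<^sup>2" using k by (intro mult_right_mono) auto
  ultimately have "c * (a\<^sup>2 + b\<^sup>2) \<le> e k1 * (a\<^sup>2 + b\<^sup>2)"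
    by (simp add: distrib_left)
  moreover have "0 < a\<^sup>2 + b\<^sup>2" using ab(2) by (simp add: sum_power2_gt_zero_iff)
  ultimately show ?thesis unfolding roots second by simp
qed

section \<open>Variational bounds for the spectral gap\<close>

definition energy :: "nat \<Rightarrow> (nat \<Rightarrow> nat \<Rightarrow> bool) \<Rightarrow> (nat \<Rightarrow> real) \<Rightarrow> real" where
  "energy n E f = (\<Sum>i<n. \<Sum>j<n. if E i j then (f i - f j)\<^sup>2 else 0) / 2"

text \<open>The substitution x = \<open>T^(1/2) f\<close>. It turns the Rayleigh quotient into
  energy over degree-weighted norm, and orthogonality to the image of the constant 1 into vanishing
  weighted mean.\<close>

definition scaled_vec :: "nat \<Rightarrow> (nat \<Rightarrow> nat \<Rightarrow> bool) \<Rightarrow> (nat \<Rightarrow> real) \<Rightarrow> real vec" where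
  "scaled_vec n E f = vec n (\<lambda>i. sqrt (degree n E i) * f i)"

lemma scaled_vec_carrier [simp]: "scaled_vec n E f \<in> carrier_vec n"
  by (simp add: scaled_vec_def)

lemma norm_laplacian_carrier [simp]: "norm_laplacian n E \<in> carrier_mat n n"
  by (simp add: norm_laplacian_def)

lemma degree_eq_sum: "real (degree n E i) = (\<Sum>j<n. if E i j then 1 else 0)"
proof -
  have "{j. j < n \<and> E i j} = {..<n} \<inter> {j. E i j}" by auto
  then show ?thesis by (simp add: degree_def sum.If_cases)
qed

lemma connected_graph_cut:
  assumes "connected_graph_on n E" "a \<in> S" "a < n" "b \<notin> S" "b < n"
  shows "\<exists>i j. i \<in> S \<and> j \<notin> S \<and> E i j"
proof (rule ccontr)
  assume no: "\<not> ?thesis"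
  have "E\<^sup>*\<^sup>* a b" using assms by (auto simp: connected_graph_on_def)
  then have "b \<in> S"
    by (induction rule: rtranclp_induct) (use no assms in blast)+
  with assms show False by simp
qed

lemma connected_degree_pos:
  assumes "connected_graph_on n E" "2 \<le> n" "i < n"
  shows "0 < degree n E i"
proof -
  define b where "b = (if i = 0 then 1 else 0 :: nat)"
  have b: "b < n" "b \<noteq> i" using assms(2) by (auto simp: b_def)
  obtain j where "E i j"
    using connected_graph_cut[of n E i "{i}" b] assms b by auto
  then have "j \<in> {j. j < n \<and> E i j}"
    using assms(1) by (auto simp: connected_graph_on_def simple_graph_on_def)
  then show ?thesis by (auto simp: degree_def card_gt_0_iff)
qed

lemma norm_laplacian_symmetric:
  assumes "simple_graph_on n E"
  shows "(norm_laplacian n E)\<^sup>T = norm_laplacian n E"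
proof -
  have "E i j = E j i" for i j using assms by (auto simp: simple_graph_on_def)
  then show ?thesis
    by (intro eq_matI) (auto simp: norm_laplacian_def mult.commute)
qed

lemma scaled_vec_norm:
  "scaled_vec n E f \<bullet> scaled_vec n E f = (\<Sum>i<n. real (degree n E i) * (f i)\<^sup>2)"
proof -
  have "(sqrt (degree n E i) * f i) * (sqrt (degree n E i) * f i) = real (degree n E i) * (f i)\<^sup>2" for i
    by (simp add: power2_eq_square algebra_simps flip: mult.assoc)
  then show ?thesis
    by (simp add: scaled_vec_def scalar_prod_def lessThan_atLeast0)
qed

text \<open>The square roots of the degrees cancel entry by entry, which needs positive degrees.
  What remains is the sum of \<open>d f\<^sup>2\<close> minus the adjacency form, and symmetry
  completes it to squared differences.\<close>

lemma scaled_vec_laplacian_form: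
  assumes E: "simple_graph_on n E" and pos: "\<And>i. i < n \<Longrightarrow> 0 < degree n E i"
  shows "scaled_vec n E f \<bullet> (norm_laplacian n E *\<^sub>v scaled_vec n E f) = energy n E f"
proof -
  let ?d = "\<lambda>i. real (degree n E i)"
  let ?S = "\<Sum>i<n. \<Sum>j<n. if E i j then f i * f j else 0"
  have sym: "E i j = E j i" for i j using E by (auto simp: simple_graph_on_def)
  have row: "sqrt (?d i) * f i * (norm_laplacian n E *\<^sub>v scaled_vec n E f) $ i
      = ?d i * (f i)\<^sup>2 - (\<Sum>j<n. if E i j then f i * f j else 0)" if i: "i < n" for i
  proof -
    have "sqrt (?d i) * f i * (norm_laplacian n E *\<^sub>v scaled_vec n E f) $ i
        = sqrt (?d i) * f i * (\<Sum>j<n. ((if i = j then 1 else 0) - (if E i j then 1 else 0) / (sqrt (?d i) * sqrt (?d j)))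
            * (sqrt (?d j) * f j))"
      using i by (simp add: norm_laplacian_def scaled_vec_def scalar_prod_def lessThan_atLeast0)
    also have "\<dots> = (\<Sum>j<n. (if i = j then ?d i * (f i)\<^sup>2 else 0) - (if E i j then f i * f j else 0))"
      unfolding sum_distrib_left
    proof (rule sum.cong[OF refl])
      fix j assume "j \<in> {..<n}"
      then have "0 < sqrt (?d i)" "0 < sqrt (?d j)" "sqrt (?d i) * sqrt (?d i) = ?d i"
        using pos[of j] pos[OF i] by auto
      then show "sqrt (?d i) * f i * (((if i = j then 1 else 0)
          - (if E i j then 1 else 0) / (sqrt (?d i) * sqrt (?d j))) * (sqrt (?d j) * f j))
          = (if i = j then ?d i * (f i)\<^sup>2 else 0) - (if E i j then f i * f j else 0)"
        by (cases "i = j"; cases "E i j") (simp_all add: field_simps power2_eq_square)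
    qed
    also have "\<dots> = ?d i * (f i)\<^sup>2 - (\<Sum>j<n. if E i j then f i * f j else 0)"
      unfolding sum_subtractf using i by simp
    finally show ?thesis .
  qed
  have "scaled_vec n E f \<bullet> (norm_laplacian n E *\<^sub>v scaled_vec n E f)
      = (\<Sum>i<n. sqrt (?d i) * f i * (norm_laplacian n E *\<^sub>v scaled_vec n E f) $ i)"
  proof -
    have "dim_vec (norm_laplacian n E *\<^sub>v scaled_vec n E f) = n"
      by (simp add: norm_laplacian_def)
    then show ?thesis
      unfolding scalar_prod_def by (simp add: scaled_vec_def lessThan_atLeast0)
  qed
  also have "\<dots> = (\<Sum>i<n. ?d i * (f i)\<^sup>2) - ?S"
    by (simp add: row sum_subtractf)
  also have "\<dots> = energy n E f"
  proof -
    have left: "(\<Sum>i<n. \<Sum>j<n. if E i j then (f i)\<^sup>2 else 0) = (\<Sum>i<n. ?d i * (f i)\<^sup>2)"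
      by (simp add: degree_eq_sum sum_distrib_right if_distrib[of "\<lambda>x. x * _"] cong: if_cong)
    have right: "(\<Sum>i<n. \<Sum>j<n. if E i j then (f j)\<^sup>2 else 0) = (\<Sum>i<n. ?d i * (f i)\<^sup>2)"
      unfolding left[symmetric] by (subst sum.swap) (simp add: sym)
    have "2 * energy n E f = (\<Sum>i<n. \<Sum>j<n. (if E i j then (f i)\<^sup>2 else 0) + (if E i j then (f j)\<^sup>2 else 0)
        - (if E i j then f i * f j else 0) - (if E i j then f i * f j else 0))"
      unfolding energy_def by (auto intro!: sum.cong simp: power2_eq_square algebra_simps)
    also have "\<dots> = 2 * ((\<Sum>i<n. ?d i * (f i)\<^sup>2) - ?S)"
      by (simp only: sum.distrib sum_subtractf left right) simp
    finally show ?thesis by simp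
  qed
  finally show ?thesis .
qed

text \<open>The test plane is spanned by the constant 1 and f. Adding a constant leaves the energy
  unchanged, and mean zero removes the cross term from the norm.\<close>

lemma lambda1_le:
  assumes conn: "connected_graph_on n E" and n: "2 \<le> n"
    and mean: "(\<Sum>i<n. real (degree n E i) * f i) = 0"
    and pos: "0 < (\<Sum>i<n. real (degree n E i) * (f i)\<^sup>2)"
    and c: "0 \<le> c" "energy n E f \<le> c * (\<Sum>i<n. real (degree n E i) * (f i)\<^sup>2)"
  shows "lambda1 n E \<le> c"
proof -
  let ?d = "\<lambda>i. real (degree n E i)"
  have E: "simple_graph_on n E" using conn by (simp add: connected_graph_on_def)
  have dpos: "0 < degree n E i" if "i < n" for i
    using connected_degree_pos[OF conn n that] .
  have form: "scaled_vec n E g \<bullet> (norm_laplacian n E *\<^sub>v scaled_vec n E g) = energy n E g" for g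
    by (rule scaled_vec_laplacian_form[OF E]) (rule dpos)
  have comb: "a \<cdot>\<^sub>v scaled_vec n E (\<lambda>_. 1) + b \<cdot>\<^sub>v scaled_vec n E f = scaled_vec n E (\<lambda>i. a + b * f i)" for a b
    by (intro eq_vecI) (auto simp: scaled_vec_def algebra_simps)
  have norm: "(\<Sum>i<n. ?d i * (a + b * f i)\<^sup>2) = a\<^sup>2 * (\<Sum>i<n. ?d i) + b\<^sup>2 * (\<Sum>i<n. ?d i * (f i)\<^sup>2)" for a b
  proof -
    have "(\<Sum>i<n. ?d i * (a + b * f i)\<^sup>2)
        = (\<Sum>i<n. a\<^sup>2 * ?d i + b\<^sup>2 * (?d i * (f i)\<^sup>2) + 2 * a * b * (?d i * f i))"
      by (intro sum.cong) (auto simp: power2_eq_square algebra_simps)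
    also have "\<dots> = a\<^sup>2 * (\<Sum>i<n. ?d i) + b\<^sup>2 * (\<Sum>i<n. ?d i * (f i)\<^sup>2) + 2 * a * b * (\<Sum>i<n. ?d i * f i)"
      by (simp only: sum.distrib sum_distrib_left)
    finally show ?thesis by (simp add: mean)
  qed
  have energy: "energy n E (\<lambda>i. a + b * f i) = b\<^sup>2 * energy n E f" for a b
  proof -
    have "(if E i j then (a + b * f i - (a + b * f j))\<^sup>2 else 0)
        = b\<^sup>2 * (if E i j then (f i - f j)\<^sup>2 else 0)" for i j
      by (simp add: power2_eq_square algebra_simps)
    then show ?thesis unfolding energy_def by (simp flip: sum_distrib_left)
  qed
  have vol: "0 < (\<Sum>i<n. ?d i)"
    using dpos n by (intro sum_pos) (auto simp: lessThan_empty_iff)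
  show ?thesis
    unfolding lambda1_def laplacian_eigenvalues_def
  proof (rule second_eigenvalue_le[OF _ _ n])
    show "norm_laplacian n E \<in> carrier_mat n n" by simp
    show "(norm_laplacian n E)\<^sup>T = norm_laplacian n E"
      by (rule norm_laplacian_symmetric[OF E])
    show "scaled_vec n E (\<lambda>_. 1) \<in> carrier_vec n" "scaled_vec n E f \<in> carrier_vec n" by auto
  next
    fix a b x
    assume x: "x = a \<cdot>\<^sub>v scaled_vec n E (\<lambda>_. 1) + b \<cdot>\<^sub>v scaled_vec n E f"
    have "b\<^sup>2 * energy n E f \<le> b\<^sup>2 * (c * (\<Sum>i<n. ?d i * (f i)\<^sup>2))"
      by (rule mult_left_mono[OF c(2)]) simp
    \<comment> \<open>Since c is nonnegative, the norm of the constant part can only help.\<close>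
    also have "\<dots> \<le> c * (\<Sum>i<n. ?d i * (a + b * f i)\<^sup>2)"
      using c(1) vol unfolding norm by (simp add: algebra_simps)
    finally show "x \<bullet> (norm_laplacian n E *\<^sub>v x) \<le> c * (x \<bullet> x)"
      unfolding x comb form scaled_vec_norm energy .
    assume "a \<noteq> 0 \<or> b \<noteq> 0"
    then show "0 < x \<bullet> x"
      unfolding x comb scaled_vec_norm norm using pos vol
      by (cases "a = 0") (auto intro!: add_pos_nonneg)
  qed
qed

text \<open>With all degrees positive, every vector has the form \<open>scaled_vec n E f\<close>, so
  the bound for functions of mean zero covers the whole orthogonal complement.\<close>

lemma lambda1_ge:
  assumes conn: "connected_graph_on n E" and n: "2 \<le> n"
    and ge: "\<And>f. (\<Sum>i<n. real (degree n E i) * f i) = 0 \<Longrightarrow>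
      c * (\<Sum>i<n. real (degree n E i) * (f i)\<^sup>2) \<le> energy n E f"
  shows "c \<le> lambda1 n E"
proof -
  let ?d = "\<lambda>i. real (degree n E i)"
  have E: "simple_graph_on n E" using conn by (simp add: connected_graph_on_def)
  have dpos: "0 < degree n E i" if "i < n" for i
    using connected_degree_pos[OF conn n that] .
  have form: "scaled_vec n E g \<bullet> (norm_laplacian n E *\<^sub>v scaled_vec n E g) = energy n E g" for g
    by (rule scaled_vec_laplacian_form[OF E]) (rule dpos)
  show ?thesis
    unfolding lambda1_def laplacian_eigenvalues_def
  proof (rule second_eigenvalue_ge[OF _ _ n])
    show "norm_laplacian n E \<in> carrier_mat n n" by simp
    show "(norm_laplacian n E)\<^sup>T = norm_laplacian n E"
      by (rule norm_laplacian_symmetric[OF E])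
    show "scaled_vec n E (\<lambda>_. 1) \<in> carrier_vec n" by simp
  next
    fix x :: "real vec"
    assume x: "x \<in> carrier_vec n" "x \<bullet> scaled_vec n E (\<lambda>_. 1) = 0"
    define f where "f = (\<lambda>i. x $ i / sqrt (?d i))"
    have xf: "x = scaled_vec n E f"
    proof (rule eq_vecI)
      fix i assume "i < dim_vec (scaled_vec n E f)"
      then show "x $ i = scaled_vec n E f $ i"
        using dpos[of i] by (simp add: scaled_vec_def f_def)
    qed (use x(1) in \<open>simp add: scaled_vec_def\<close>)
    have "x \<bullet> scaled_vec n E (\<lambda>_. 1) = (\<Sum>i<n. ?d i * f i)"
      unfolding xf scaled_vec_def scalar_prod_def by (auto intro!: sum.cong simp: lessThan_atLeast0)
    with x(2) have "(\<Sum>i<n. ?d i * f i) = 0" by simp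
    then show "c * (x \<bullet> x) \<le> x \<bullet> (norm_laplacian n E *\<^sub>v x)"
      unfolding xf form scaled_vec_norm by (rule ge)
  qed
qed

section \<open>Transfer to arbitrary connected graphs\<close>

lemma (in ordered_graph) edge_energy_eq: "edge_energy f = energy n E f"
proof -
  let ?F = "\<lambda>i j. if E i j then (f i - f j)\<^sup>2 else 0"
  have E: "E i j = E j i" for i j using edge_sym by blast
  have "edge_energy f = (\<Sum>(i, j) | i < j \<and> j < n. ?F i j)"
    unfolding edge_energy_def
  proof (rule sum.mono_neutral_cong_left)
    show "finite {(i, j). i < j \<and> j < n}"
      by (rule finite_subset[of _ "{..<n} \<times> {..<n}"]) auto
  qed (use edge_less in \<open>auto simp: power2_commute split: if_splits\<close>)
  moreover have "(\<Sum>i<n. \<Sum>j<n. ?F i j) = 2 * (\<Sum>(i, j) | i < j \<and> j < n. ?F i j)"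
    by (rule sum_pairs_less_double) (use E edge_irrefl in \<open>auto simp: power2_commute\<close>)
  ultimately show ?thesis by (simp add: energy_def)
qed

text \<open>Relabelling the vertices by a permutation that sorts f makes f monotone and preserves
  degree sums and energy. Each proper initial segment of the new order is left by an edge because
  the graph is connected.\<close>

lemma connected_weighted_variance_le:
  fixes \<delta> K :: real
  assumes conn: "connected_graph_on n E" and n: "2 \<le> n"
    and mean: "(\<Sum>i<n. real (degree n E i) * f i) = 0"
    and K: "0 < K" "1 + sqrt (2 * K * n) \<le> \<delta>"
  shows "(\<Sum>i<n. real (degree n E i) * (f i)\<^sup>2)
    \<le> ((real n + 2 * \<delta>) ^ 3 / 54 + real n ^ 3 / K) * energy n E f"
proof -
  define p where "p = sort_key f [0..<n]"
  define \<sigma> where "\<sigma> = (!) p"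
  have p: "length p = n" "set p = {..<n}" "distinct p" "sorted (map f p)"
    by (auto simp: p_def)
  have bij: "bij_betw \<sigma> {..<n} {..<n}"
    unfolding \<sigma>_def using p by (intro bij_betw_nth) auto
  have \<sigma>_less: "\<sigma> i < n" if "i < n" for i
    using bij_betwE[OF bij] that by auto
  \<comment> \<open>List access is unspecified past the end, so edges are restricted to valid
    indices explicitly.\<close>
  define E' where "E' = (\<lambda>i j. i < n \<and> j < n \<and> E (\<sigma> i) (\<sigma> j))"
  have deg: "degree n E' i = degree n E (\<sigma> i)" if "i < n" for i
  proof -
    have "bij_betw \<sigma> {j. j < n \<and> E' i j} {j. j < n \<and> E (\<sigma> i) j}"
    proof (rule bij_betw_subset[OF bij])
      show "\<sigma> ` {j. j < n \<and> E' i j} = {j. j < n \<and> E (\<sigma> i) j}"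
      proof (intro equalityI subsetI)
        fix b assume b: "b \<in> {j. j < n \<and> E (\<sigma> i) j}"
        then obtain j where "j < n" "b = \<sigma> j"
          using bij_betw_imp_surj_on[OF bij] by (metis (no_types, lifting) image_iff lessThan_iff mem_Collect_eq)
        with b that show "b \<in> \<sigma> ` {j. j < n \<and> E' i j}" by (auto simp: E'_def)
      qed (auto simp: E'_def \<sigma>_less)
    qed auto
    then show ?thesis unfolding degree_def by (rule bij_betw_same_card)
  qed
  have reindex: "(\<Sum>i<n. g (\<sigma> i)) = (\<Sum>i<n. g i)" for g :: "nat \<Rightarrow> real"
    by (rule sum.reindex_bij_betw[OF bij])
  interpret ordered_graph n E'
  proof
    show "simple_graph_on n E'"
      using conn by (auto simp: simple_graph_on_def connected_graph_on_def E'_def)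
    fix k assume k: "0 < k" "k < n"
    have inj: "\<sigma> i = \<sigma> j \<longleftrightarrow> i = j" if "i < n" "j < n" for i j
      using bij_betw_imp_inj_on[OF bij] that by (auto simp: inj_on_def)
    have "\<sigma> k \<notin> \<sigma> ` {..<k}" using k inj by force
    then obtain a b where ab: "a \<in> \<sigma> ` {..<k}" "b \<notin> \<sigma> ` {..<k}" "E a b"
      using connected_graph_cut[OF conn, of "\<sigma> 0" "\<sigma> ` {..<k}" "\<sigma> k"] k \<sigma>_less by auto
    then obtain i where i: "i < k" "a = \<sigma> i" by auto
    have "b < n" using ab conn by (auto simp: connected_graph_on_def simple_graph_on_def)
    then obtain j where j: "j < n" "b = \<sigma> j"
      using bij_betw_imp_surj_on[OF bij] by (metis image_iff lessThan_iff)
    have "k \<le> j" using ab(2) j by (metis image_eqI lessThan_iff not_le)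
    then show "\<exists>i j. i < k \<and> k \<le> j \<and> E' i j"
      using i j ab k by (intro exI[of _ i] exI[of _ j]) (auto simp: E'_def)
  qed
  have "(\<Sum>i<n. real (degree n E' i) * (f (\<sigma> i))\<^sup>2)
    \<le> ((real n + 2 * \<delta>) ^ 3 / 54 + real n ^ 3 / K) * edge_energy (\<lambda>i. f (\<sigma> i))"
  proof (rule weighted_variance_le[OF _ _ K n])
    show "f (\<sigma> i) \<le> f (\<sigma> j)" if "i \<le> j" "j < n" for i j
      using sorted_nth_mono[OF p(4), of i j] that p(1) by (simp add: \<sigma>_def)
    have "(\<Sum>i<n. real (degree n E' i) * f (\<sigma> i)) = (\<Sum>i<n. real (degree n E (\<sigma> i)) * f (\<sigma> i))"
      by (intro sum.cong) (auto simp: deg)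
    also have "\<dots> = 0" using reindex[of "\<lambda>i. real (degree n E i) * f i"] mean by simp
    finally show "(\<Sum>i<n. real (degree n E' i) * f (\<sigma> i)) = 0" .
  qed
  moreover have "(\<Sum>i<n. real (degree n E' i) * (f (\<sigma> i))\<^sup>2) = (\<Sum>i<n. real (degree n E i) * (f i)\<^sup>2)"
  proof -
    have "(\<Sum>i<n. real (degree n E' i) * (f (\<sigma> i))\<^sup>2) = (\<Sum>i<n. real (degree n E (\<sigma> i)) * (f (\<sigma> i))\<^sup>2)"
      by (intro sum.cong) (auto simp: deg)
    then show ?thesis using reindex[of "\<lambda>i. real (degree n E i) * (f i)\<^sup>2"] by simp
  qed
  moreover have "edge_energy (\<lambda>i. f (\<sigma> i)) = energy n E f"
  proof -
    let ?F = "\<lambda>i j. if E i j then (f i - f j)\<^sup>2 else 0"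
    have "2 * edge_energy (\<lambda>i. f (\<sigma> i)) = (\<Sum>i<n. \<Sum>j<n. ?F (\<sigma> i) (\<sigma> j))"
      unfolding edge_energy_eq energy_def by (auto intro!: sum.cong simp: E'_def)
    also have "\<dots> = (\<Sum>i<n. \<Sum>j<n. ?F (\<sigma> i) j)"
      by (intro sum.cong refl reindex)
    also have "\<dots> = (\<Sum>i<n. \<Sum>j<n. ?F i j)"
      by (rule reindex)
    finally show ?thesis by (simp add: energy_def)
  qed
  ultimately show ?thesis by simp
qed

text \<open>The threshold for sparse cuts is \<open>K = sqrt n\<close>; any \<open>K\<close> with \<open>1 << K << n\<close> makes the error terms \<open>o(n\<^sup>3)\<close>.\<close>

definition gap_bound :: "nat \<Rightarrow> real" where
  "gap_bound n = (real n + 2 * (1 + sqrt (2 * sqrt (real n) * real n))) ^ 3 / 54 + real n ^ 3 / sqrt (real n)"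

lemma lambda1_lower_bound:
  assumes "connected_graph_on n E" "2 \<le> n"
  shows "1 / gap_bound n \<le> lambda1 n E"
proof (rule lambda1_ge[OF assms])
  fix f assume mean: "(\<Sum>i<n. real (degree n E i) * f i) = 0"
  have "0 < gap_bound n"
    unfolding gap_bound_def using assms(2)
    by (intro add_pos_pos divide_pos_pos zero_less_power) (auto intro!: add_pos_nonneg)
  moreover have "(\<Sum>i<n. real (degree n E i) * (f i)\<^sup>2) \<le> gap_bound n * energy n E f"
    unfolding gap_bound_def using assms(2)
    by (intro connected_weighted_variance_le[OF assms mean]) auto
  ultimately show "1 / gap_bound n * (\<Sum>i<n. real (degree n E i) * (f i)\<^sup>2) \<le> energy n E f"
    by (simp add: pos_divide_le_eq mult.commute)
qed

section \<open>Barbell graphs\<close>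

text \<open>The first k and the last k vertices form cliques. Joining all consecutive vertices
  supplies the path from k - 1 to n - k, whose ends belong to the cliques.\<close>

definition barbell :: "nat \<Rightarrow> nat \<Rightarrow> nat \<Rightarrow> nat \<Rightarrow> bool" where
  "barbell n k i j \<longleftrightarrow> i < n \<and> j < n \<and> i \<noteq> j \<and>
    ((i < k \<and> j < k) \<or> (n - k \<le> i \<and> n - k \<le> j) \<or> i = Suc j \<or> j = Suc i)"

text \<open>The index is clamped to the path, from k - 1 to n - k, then doubled and centred so that
  the profile is odd under i -> n - 1 - i.\<close>

definition barbell_profile :: "nat \<Rightarrow> nat \<Rightarrow> nat \<Rightarrow> real" where
  "barbell_profile n k i = 2 * real (max (k - 1) (min i (n - k))) - (real n - 1)"

lemma barbell_connected: "connected_graph_on n (barbell n k)"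
proof -
  have simple: "simple_graph_on n (barbell n k)"
    by (auto simp: simple_graph_on_def barbell_def)
  have up: "(barbell n k)\<^sup>*\<^sup>* 0 j" if "j < n" for j
    using that
  proof (induction j)
    case (Suc j)
    then have "barbell n k j (Suc j)" by (auto simp: barbell_def)
    with Suc show ?case by (meson Suc_lessD rtranclp.rtrancl_into_rtrancl)
  qed simp
  have "symp (barbell n k)" by (auto simp: symp_def barbell_def)
  then have "symp (barbell n k)\<^sup>*\<^sup>*" by (rule symp_rtranclp)
  then have "(barbell n k)\<^sup>*\<^sup>* i j" if "i < n" "j < n" for i j
    using up[OF that(1)] up[OF that(2)] by (meson rtranclp_trans sympD)
  with simple show ?thesis by (simp add: connected_graph_on_def)
qed

context
  fixes n k :: nat
  assumes k: "2 \<le> k" "2 * k \<le> n"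
begin

text \<open>The number of edges from k - 1 to n - k, and also the absolute value of the profile on
  both cliques.\<close>

abbreviation path_length :: nat where
  "path_length \<equiv> n - 2 * k + 1"

lemma clamp_eq:
  "i < k \<Longrightarrow> max (k - 1) (min i (n - k)) = k - 1"
  "n - k \<le> i \<Longrightarrow> max (k - 1) (min i (n - k)) = n - k"
  "k \<le> i \<Longrightarrow> i < n - k \<Longrightarrow> max (k - 1) (min i (n - k)) = i"
  using k by (auto simp: max_def min_def)

lemma barbell_profile_flip:
  assumes "i < n"
  shows "barbell_profile n k (n - 1 - i) = - barbell_profile n k i"
proof -
  define a where "a = max (k - 1) (min i (n - k))"
  define b where "b = max (k - 1) (min (n - 1 - i) (n - k))"
  consider "i < k" | "n - k \<le> i" | "k \<le> i" "i < n - k" by linarith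
  then have "a + b = n - 1"
  proof cases
    case 1
    then have "n - k \<le> n - 1 - i" by linarith
    then have "b = n - k" unfolding b_def by (rule clamp_eq(2))
    moreover have "a = k - 1" unfolding a_def using 1 by (rule clamp_eq(1))
    ultimately show ?thesis using k by simp
  next
    case 2
    then have "n - 1 - i < k" using assms by linarith
    then have "b = k - 1" unfolding b_def by (rule clamp_eq(1))
    moreover have "a = n - k" unfolding a_def using 2 by (rule clamp_eq(2))
    ultimately show ?thesis using k by simp
  next
    case 3
    then have "k \<le> n - 1 - i" "n - 1 - i < n - k" by linarith+
    then have "b = n - 1 - i" unfolding b_def by (rule clamp_eq(3))
    moreover have "a = i" unfolding a_def using 3 by (rule clamp_eq(3))
    ultimately show ?thesis using assms by simp
  qed
  then have "real a + real b = real n - 1" using assms by linarith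
  then show ?thesis
    unfolding barbell_profile_def a_def[symmetric] b_def[symmetric] by simp
qed

lemma sum_flip: "(\<Sum>i<n. g (n - 1 - i)) = (\<Sum>i<n. g i)" for g :: "nat \<Rightarrow> real"
  using sum.nat_diff_reindex[of g n] by simp

lemma barbell_degree_flip:
  assumes "i < n"
  shows "degree n (barbell n k) (n - 1 - i) = degree n (barbell n k) i"
proof -
  have "bij_betw (\<lambda>j. n - 1 - j) {j. j < n \<and> barbell n k i j} {j. j < n \<and> barbell n k (n - 1 - i) j}"
  proof (rule bij_betw_byWitness[where f' = "\<lambda>j. n - 1 - j"])
    have flip: "barbell n k (n - 1 - i) (n - 1 - j) = barbell n k i j" if ij: "i < n" "j < n" for i j
    proof -
      have "(n - 1 - i < k) = (n - k \<le> i)" "(n - 1 - j < k) = (n - k \<le> j)"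
        "(n - k \<le> n - 1 - i) = (i < k)" "(n - k \<le> n - 1 - j) = (j < k)"
        "(n - 1 - i = Suc (n - 1 - j)) = (j = Suc i)" "(n - 1 - j = Suc (n - 1 - i)) = (i = Suc j)"
        "(n - 1 - i = n - 1 - j) = (i = j)" "n - 1 - i < n" "n - 1 - j < n"
        using ij k by linarith+
      then show ?thesis unfolding barbell_def using ij by blast
    qed
    show "(\<lambda>j. n - 1 - j) ` {j. j < n \<and> barbell n k i j} \<subseteq> {j. j < n \<and> barbell n k (n - 1 - i) j}"
      using flip assms by auto
    show "(\<lambda>j. n - 1 - j) ` {j. j < n \<and> barbell n k (n - 1 - i) j} \<subseteq> {j. j < n \<and> barbell n k i j}"
    proof clarify
      fix j assume j: "j < n" "barbell n k (n - 1 - i) j"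
      then show "n - 1 - j < n \<and> barbell n k i (n - 1 - j)"
        using flip[of i "n - 1 - j"] assms by simp
    qed
  qed auto
  then show ?thesis unfolding degree_def by (metis bij_betw_same_card)
qed

text \<open>The flip i -> n - 1 - i preserves degrees and negates the profile, so the sum equals its
  own negative.\<close>

lemma barbell_mean:
  "(\<Sum>i<n. real (degree n (barbell n k) i) * barbell_profile n k i) = 0"
proof -
  let ?g = "\<lambda>i. real (degree n (barbell n k) i) * barbell_profile n k i"
  have "(\<Sum>i<n. ?g i) = (\<Sum>i<n. ?g (n - 1 - i))" by (rule sum_flip[of ?g, symmetric])
  also have "\<dots> = (\<Sum>i<n. - ?g i)"
    by (intro sum.cong refl) (simp only: lessThan_iff barbell_profile_flip barbell_degree_flip mult_minus_right)
  finally show ?thesis by (simp add: sum_negf)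
qed

lemma barbell_degree_ge:
  assumes "i < n" "i < k \<or> n - k \<le> i"
  shows "k - 1 \<le> degree n (barbell n k) i"
proof -
  have fin: "finite {j. j < n \<and> barbell n k i j}" by simp
  show ?thesis
    using assms(2)
  proof
    assume i: "i < k"
    then have "card ({..<k} - {i}) \<le> degree n (barbell n k) i"
      unfolding degree_def using k by (intro card_mono fin) (auto simp: barbell_def)
    then show ?thesis using i by simp
  next
    assume i: "n - k \<le> i"
    then have "card ({n - k..<n} - {i}) \<le> degree n (barbell n k) i"
      unfolding degree_def using k assms(1) by (intro card_mono fin) (auto simp: barbell_def)
    then show ?thesis using i k assms(1) by simp
  qed
qed

lemma barbell_profile_clique:
  assumes "i < n" "i < k \<or> n - k \<le> i"
  shows "(barbell_profile n k i)\<^sup>2 = (real path_length)\<^sup>2"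
  using assms(2)
proof
  assume "i < k"
  then have "max (k - 1) (min i (n - k)) = k - 1" by (rule clamp_eq)
  then have "barbell_profile n k i = - real path_length"
    using k by (simp add: barbell_profile_def of_nat_diff)
  then show ?thesis by (simp only: power2_minus)
next
  assume "n - k \<le> i"
  then have "max (k - 1) (min i (n - k)) = n - k" by (rule clamp_eq)
  then have "barbell_profile n k i = real path_length"
    using k by (simp add: barbell_profile_def of_nat_diff)
  then show ?thesis by simp
qed

text \<open>Only the 2 k clique vertices are kept; each has degree at least k - 1.\<close>

lemma barbell_norm_ge:
  "2 * real k * (real k - 1) * (real path_length)\<^sup>2
    \<le> (\<Sum>i<n. real (degree n (barbell n k) i) * (barbell_profile n k i)\<^sup>2)"
proof -
  let ?C = "{..<k} \<union> {n - k..<n}"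
  have "card ?C = 2 * k"
    using k by (subst card_Un_disjoint) auto
  then have "2 * real k * (real k - 1) * (real path_length)\<^sup>2
      = (\<Sum>i\<in>?C. (real k - 1) * (real path_length)\<^sup>2)"
    by simp
  also have "\<dots> \<le> (\<Sum>i\<in>?C. real (degree n (barbell n k) i) * (barbell_profile n k i)\<^sup>2)"
  proof (rule sum_mono)
    fix i assume "i \<in> ?C"
    then have i: "i < n" "i < k \<or> n - k \<le> i" using k by auto
    have "real k - 1 \<le> real (degree n (barbell n k) i)"
      using barbell_degree_ge[OF i] by linarith
    then show "(real k - 1) * (real path_length)\<^sup>2
        \<le> real (degree n (barbell n k) i) * (barbell_profile n k i)\<^sup>2"
      unfolding barbell_profile_clique[OF i] by (intro mult_right_mono) auto
  qed
  also have "\<dots> \<le> (\<Sum>i<n. real (degree n (barbell n k) i) * (barbell_profile n k i)\<^sup>2)"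
    using k by (intro sum_mono2) auto
  finally show ?thesis .
qed

text \<open>The profile is constant on each clique, so only path edges contribute, each with
  difference 2 and hence energy 4.\<close>

lemma barbell_energy_le: "energy n (barbell n k) (barbell_profile n k) \<le> 4 * real path_length"
proof -
  let ?f = "barbell_profile n k"
  \<comment> \<open>Marks a path edge in its upward orientation; adding the transpose accounts for
    the ordered pairs in \<open>energy\<close>.\<close>
  let ?g = "\<lambda>i j. if j = Suc i \<and> i \<in> {k - 1..<n - k} then 4 else 0 :: real"
  have edge: "(?f i - ?f j)\<^sup>2 \<le> ?g i j + ?g j i" if "barbell n k i j" for i j
  proof (cases "j = Suc i \<and> i \<in> {k - 1..<n - k} \<or> i = Suc j \<and> j \<in> {k - 1..<n - k}")
    case True
    then have "?f i - ?f j = 2 \<or> ?f i - ?f j = - 2"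
      by (auto simp: barbell_profile_def)
    then have "(?f i - ?f j)\<^sup>2 = 4" by auto
    with True show ?thesis by auto
  next
    case False
    from that consider "i < k" "j < k" | "n - k \<le> i" "n - k \<le> j" | "i = Suc j" | "j = Suc i"
      unfolding barbell_def by blast
    then have "i < k \<and> j < k \<or> n - k \<le> i \<and> n - k \<le> j"
    proof cases
      case 3
      with False have "j < k - 1 \<or> n - k \<le> j" by auto
      with 3 show ?thesis by auto
    next
      case 4
      with False have "i < k - 1 \<or> n - k \<le> i" by auto
      with 4 show ?thesis by auto
    qed auto
    then have "max (k - 1) (min i (n - k)) = max (k - 1) (min j (n - k))"
      using clamp_eq(1,2) by metis
    then show ?thesis by (simp add: barbell_profile_def)
  qed
  have g: "(\<Sum>i<n. \<Sum>j<n. ?g i j) = 4 * real path_length"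
  proof -
    have "(\<Sum>j<n. ?g i j) = (if i \<in> {k - 1..<n - k} then 4 else 0)" if "i < n" for i
    proof (cases "i \<in> {k - 1..<n - k}")
      case True
      then have "Suc i < n" using k by auto
      with True show ?thesis by simp
    next
      case False
      then show ?thesis by (simp only: if_False simp_thms sum.neutral_const)
    qed
    then have "(\<Sum>i<n. \<Sum>j<n. ?g i j) = (\<Sum>i<n. if i \<in> {k - 1..<n - k} then 4 else 0)"
      by (intro sum.cong) auto
    also have "\<dots> = (\<Sum>i\<in>{..<n} \<inter> {k - 1..<n - k}. 4)"
      by (rule sum.inter_restrict[symmetric]) simp
    also have "{..<n} \<inter> {k - 1..<n - k} = {k - 1..<n - k}" by auto
    also have "(\<Sum>i\<in>{k - 1..<n - k}. 4) = 4 * real (n - k - (k - 1))" by simp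
    also have "n - k - (k - 1) = path_length" using k by linarith
    finally show ?thesis .
  qed
  have "(\<Sum>i<n. \<Sum>j<n. if barbell n k i j then (?f i - ?f j)\<^sup>2 else 0)
      \<le> (\<Sum>i<n. \<Sum>j<n. ?g i j + ?g j i)"
    using edge by (intro sum_mono) auto
  also have "\<dots> = (\<Sum>i<n. \<Sum>j<n. ?g i j) + (\<Sum>i<n. \<Sum>j<n. ?g j i)"
    by (simp only: sum.distrib)
  also have "(\<Sum>i<n. \<Sum>j<n. ?g j i) = (\<Sum>i<n. \<Sum>j<n. ?g i j)"
    by (rule sum.swap)
  finally show ?thesis unfolding g energy_def by simp
qed

lemma barbell_lambda1_le:
  "lambda1 n (barbell n k) \<le> 2 / (real k * (real k - 1) * real path_length)"
proof (rule lambda1_le[OF barbell_connected _ barbell_mean])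
  let ?N = "\<Sum>i<n. real (degree n (barbell n k) i) * (barbell_profile n k i)\<^sup>2"
  let ?D = "real k * (real k - 1) * real path_length"
  have D: "0 < ?D" using k by (intro mult_pos_pos) auto
  have N: "2 * ?D * real path_length \<le> ?N"
    using barbell_norm_ge by (simp add: power2_eq_square mult.assoc)
  show "2 \<le> n" using k by simp
  have "0 < 2 * ?D * real path_length"
    by (rule mult_pos_pos[OF mult_pos_pos[OF _ D]]) auto
  with N show "0 < ?N" by linarith
  have c: "0 \<le> 2 / ?D" using less_imp_le[OF D] by (rule divide_nonneg_nonneg[rotated]) simp
  then show "0 \<le> 2 / ?D" .
  have "energy n (barbell n k) (barbell_profile n k) \<le> 4 * real path_length"
    by (rule barbell_energy_le)
  also have "\<dots> = 2 / ?D * (2 * ?D * real path_length)" using D by (simp add: field_simps)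
  also have "\<dots> \<le> 2 / ?D * ?N"
    by (rule mult_left_mono[OF N c])
  finally show "energy n (barbell n k) (barbell_profile n k) \<le> 2 / ?D * ?N" .
qed

end

section \<open>Asymptotics of the minimal spectral gap\<close>

text \<open>Finiteness is what makes \<open>Min\<close> in \<open>alpha\<close> a genuine minimum; a
  graph is determined by its edge set inside a finite square.\<close>

lemma finite_connected_graphs: "finite {E. connected_graph_on n E}"
proof (rule finite_imageD)
  show "finite ((\<lambda>E. {(i, j). E i j}) ` {E. connected_graph_on n E})"
    by (rule finite_subset[of _ "Pow ({..<n} \<times> {..<n})"])
      (auto simp: connected_graph_on_def simple_graph_on_def)
  show "inj_on (\<lambda>E. {(i, j). E i j}) {E. connected_graph_on n E}"
    by (auto simp: inj_on_def fun_eq_iff)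
qed

lemma finite_lambda1_values: "finite {lambda1 n E | E. connected_graph_on n E}"
  using finite_imageI[OF finite_connected_graphs, of "lambda1 n" n] by (simp add: setcompr_eq_image)

lemma alpha_ge:
  assumes "2 \<le> n"
  shows "1 / gap_bound n \<le> alpha n"
  unfolding alpha_def
proof (subst Min_ge_iff[OF finite_lambda1_values])
  show "{lambda1 n E |E. connected_graph_on n E} \<noteq> {}"
    using barbell_connected by blast
qed (use lambda1_lower_bound assms in auto)

lemma alpha_le:
  assumes "6 \<le> n"
  shows "alpha n \<le> 54 / ((real n - 2) * (real n - 5) * real n)"
proof -
  \<comment> \<open>Asymptotically \<open>k\<^sup>2 (n - 2 k)\<close> is largest at k = n / 3.
    Rounding down costs at most 2 / 3 in k, which gives the shifts 2 and 5 in the bound.\<close>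
  define k where "k = n div 3"
  have div: "3 * k \<le> n" "n \<le> 3 * k + 2" unfolding k_def by presburger+
  have k: "2 \<le> k" "2 * k \<le> n" using div assms by linarith+
  have ge: "(real n - 2) / 3 \<le> real k" "(real n - 5) / 3 \<le> real k - 1"
    "real n / 3 \<le> real (n - 2 * k + 1)"
    using div by (simp_all add: of_nat_diff)
  have "alpha n \<le> lambda1 n (barbell n k)"
    unfolding alpha_def by (rule Min_le[OF finite_lambda1_values]) (use barbell_connected in auto)
  also have "\<dots> \<le> 2 / (real k * (real k - 1) * real (n - 2 * k + 1))"
    by (rule barbell_lambda1_le[OF k])
  also have "\<dots> \<le> 2 / ((real n - 2) / 3 * ((real n - 5) / 3) * (real n / 3))"
  proof (rule divide_left_mono)
    show "(real n - 2) / 3 * ((real n - 5) / 3) * (real n / 3)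
        \<le> real k * (real k - 1) * real (n - 2 * k + 1)"
      using ge assms k by (intro mult_mono mult_nonneg_nonneg) auto
    show "0 < real k * (real k - 1) * real (n - 2 * k + 1)
        * ((real n - 2) / 3 * ((real n - 5) / 3) * (real n / 3))"
      using assms k by (intro mult_pos_pos) auto
  qed simp
  also have "\<dots> = 54 / ((real n - 2) * (real n - 5) * real n)" by simp
  finally show ?thesis .
qed

theorem theorem1p4:
  shows "(\<lambda>n. alpha n * real n ^ 3 / 54) \<longlonglongrightarrow> 1"
proof (rule tendsto_sandwich)
  show "\<forall>\<^sub>F n in sequentially. 1 / gap_bound n * real n ^ 3 / 54 \<le> alpha n * real n ^ 3 / 54"
    using eventually_ge_at_top[of 2]
    by eventually_elim (intro divide_right_mono mult_right_mono alpha_ge, auto)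
  show "\<forall>\<^sub>F n in sequentially. alpha n * real n ^ 3 / 54
      \<le> 54 / ((real n - 2) * (real n - 5) * real n) * real n ^ 3 / 54"
    using eventually_ge_at_top[of 6]
    by eventually_elim (intro divide_right_mono mult_right_mono alpha_le, auto)
  \<comment> \<open>In \<open>gap_bound\<close> the shift of n has order \<open>n^(3/4)\<close> and
    the second summand is \<open>n^(5/2)\<close>, so the leading term is
    \<open>n^3 / 54\<close>.\<close>
  show "(\<lambda>n. 1 / gap_bound n * real n ^ 3 / 54) \<longlonglongrightarrow> 1"
    unfolding gap_bound_def by real_asymp
  show "(\<lambda>n. 54 / ((real n - 2) * (real n - 5) * real n) * real n ^ 3 / 54) \<longlonglongrightarrow> 1"
    by real_asymp
qed

end
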